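(* Let $G$ be a finite abelian group of rank $n$ and let $V$ be a faithful complex representation of $G$ of dimension $n$. Then every faithful covariant $\varphi\colon V\to V$ of $G$ is dominant. Hence $\operatorname{covdim} G=n$.
   Context: The base field is $\mathbb C$; all $G$-modules (representations) are finite-dimensional over $\mathbb C$. A covariant of a finite group $G$ is a $G$-equivariant morphism of varieties (polynomial map) $\varphi\colon V\to W$ between $G$-modules; its dimension is $\dim\varphi:=\dim\overline{\varphi(V)}$. It is faithful if $G$ acts faithfully on $\varphi(V)$ (equivalently, some point of $\varphi(V)$ has trivial stabilizer in $G$). The covariant dimension is $\operatorname{covdim} G:=\min\{\dim\varphi\mid \varphi\text{ a faithful covariant of }G\}$, over all pairs of $G$-modules $V,W$. The rank of a finite abelian group $G$ is the number $n$ of factors in a decomposition $G\simeq \mathbb Z/d_1\times\cdots\times\mathbb Z/d_n$ with $d_1>1$ and $d_1\mid d_2\mid\cdots\mid d_n$ (the minimal number of generators). *)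

theory Defs
  imports
    "HOL-Algebra.Algebra"
    "HOL-Analysis.Abstract_Topology"
    "HOL-Library.Extended_Nat"
    "Jordan_Normal_Form.Matrix"
begin

section \<open>Rank of a finite abelian group\<close>

definition has_rank :: "('g, 'b) monoid_scheme \<Rightarrow> nat \<Rightarrow> bool" where
  "has_rank G n \<longleftrightarrow>
     (\<exists>d :: nat \<Rightarrow> nat.
        (\<forall>i<n. 1 < d i) \<and>
        (\<forall>i. Suc i < n \<longrightarrow> d i dvd d (Suc i)) \<and>
        G \<cong> product_group {..<n} (\<lambda>i. integer_mod_group (d i)))"

section \<open>Affine space over the complex numbers\<close>

text \<open>Polynomial functions on \<open>carrier_vec n\<close>, as finite sums of terms
  \<open>c a * x\<^sub>0 ^ a 0 * \<dots> * x\<^sub>n\<^sub>-\<^sub>1 ^ a (n - 1)\<close>. Nothing is required of the values of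
  \<open>f\<close> on vectors of another dimension, and exponents \<open>a i\<close> with \<open>n \<le> i\<close> are irrelevant.\<close>

definition polyfun :: "nat \<Rightarrow> (complex vec \<Rightarrow> complex) \<Rightarrow> bool" where
  "polyfun n f \<longleftrightarrow>
     (\<exists>(A :: (nat \<Rightarrow> nat) set) (c :: (nat \<Rightarrow> nat) \<Rightarrow> complex). finite A \<and>
        (\<forall>x\<in>carrier_vec n. f x = (\<Sum>a\<in>A. c a * (\<Prod>i<n. x $ i ^ a i))))"

definition polymap :: "nat \<Rightarrow> nat \<Rightarrow> (complex vec \<Rightarrow> complex vec) \<Rightarrow> bool" where
  "polymap m k \<phi> \<longleftrightarrow>
     \<phi> \<in> carrier_vec m \<rightarrow> carrier_vec k \<and> (\<forall>i<k. polyfun m (\<lambda>x. \<phi> x $ i))"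

definition zero_locus :: "nat \<Rightarrow> (complex vec \<Rightarrow> complex) set \<Rightarrow> complex vec set" where
  "zero_locus n F = {x \<in> carrier_vec n. \<forall>f\<in>F. f x = 0}"

definition algebraic_set :: "nat \<Rightarrow> complex vec set \<Rightarrow> bool" where
  "algebraic_set n S \<longleftrightarrow> (\<exists>F. (\<forall>f\<in>F. polyfun n f) \<and> S = zero_locus n F)"

definition zariski :: "nat \<Rightarrow> complex vec topology" where
  "zariski n = topology (\<lambda>U. U \<subseteq> carrier_vec n \<and> algebraic_set n (carrier_vec n - U))"

lemma polyfun_mult:
  assumes "polyfun n f" "polyfun n g"
  shows "polyfun n (\<lambda>x. f x * g x)"
proof -
  obtain A c where A: "finite A"
    "\<And>x. x \<in> carrier_vec n \<Longrightarrow> f x = (\<Sum>a\<in>A. c a * (\<Prod>i<n. x $ i ^ a i))"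
    using assms(1) by (auto simp: polyfun_def)
  obtain B d where B: "finite B"
    "\<And>x. x \<in> carrier_vec n \<Longrightarrow> g x = (\<Sum>b\<in>B. d b * (\<Prod>i<n. x $ i ^ b i))"
    using assms(2) by (auto simp: polyfun_def)
  define h :: "(nat \<Rightarrow> nat) \<times> (nat \<Rightarrow> nat) \<Rightarrow> nat \<Rightarrow> nat" where "h = (\<lambda>(a, b) i. a i + b i)"
  define e where "e = (\<lambda>k. \<Sum>p\<in>{p \<in> A \<times> B. h p = k}. c (fst p) * d (snd p))"
  have "f x * g x = (\<Sum>k\<in>h ` (A \<times> B). e k * (\<Prod>i<n. x $ i ^ k i))"
    if x: "x \<in> carrier_vec n" for x
  proof -
    have "f x * g x =
        (\<Sum>p\<in>A \<times> B. c (fst p) * (\<Prod>i<n. x $ i ^ fst p i) * (d (snd p) * (\<Prod>i<n. x $ i ^ snd p i)))"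
      by (simp add: A(2) B(2) x sum_product sum.cartesian_product case_prod_unfold)
    also have "\<dots> = (\<Sum>p\<in>A \<times> B. c (fst p) * d (snd p) * (\<Prod>i<n. x $ i ^ h p i))"
      by (rule sum.cong) (auto simp: h_def power_add prod.distrib)
    also have "\<dots> = (\<Sum>k\<in>h ` (A \<times> B). \<Sum>p\<in>{p \<in> A \<times> B. h p = k}.
        c (fst p) * d (snd p) * (\<Prod>i<n. x $ i ^ h p i))"
      by (rule sum.image_gen) (use A B in auto)
    also have "\<dots> = (\<Sum>k\<in>h ` (A \<times> B). e k * (\<Prod>i<n. x $ i ^ k i))"
      unfolding e_def sum_distrib_right by (intro sum.cong refl) auto
    finally show ?thesis .
  qed
  moreover have "finite (h ` (A \<times> B))"
    using A B by auto
  ultimately show ?thesis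
    unfolding polyfun_def by blast
qed

lemma istopology_zariski:
  "istopology (\<lambda>U. U \<subseteq> carrier_vec n \<and> algebraic_set n (carrier_vec n - U))"
  unfolding istopology_def
proof (intro conjI allI impI)
  fix S T :: "complex vec set"
  assume S: "S \<subseteq> carrier_vec n \<and> algebraic_set n (carrier_vec n - S)"
    and T: "T \<subseteq> carrier_vec n \<and> algebraic_set n (carrier_vec n - T)"
  show "S \<inter> T \<subseteq> carrier_vec n"
    using S by blast
  obtain F where F: "\<forall>f\<in>F. polyfun n f" "carrier_vec n - S = zero_locus n F"
    using S by (auto simp: algebraic_set_def)
  obtain H where H: "\<forall>f\<in>H. polyfun n f" "carrier_vec n - T = zero_locus n H"
    using T by (auto simp: algebraic_set_def)
  let ?P = "(\<lambda>(f, g) x. f x * g x) ` (F \<times> H)"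
  have "\<forall>f\<in>?P. polyfun n f"
    using F H polyfun_mult by auto
  moreover have "carrier_vec n - S \<inter> T = zero_locus n F \<union> zero_locus n H"
    using F H by blast
  moreover have "zero_locus n F \<union> zero_locus n H = zero_locus n ?P"
    unfolding zero_locus_def by fastforce
  ultimately show "algebraic_set n (carrier_vec n - S \<inter> T)"
    unfolding algebraic_set_def by metis
next
  fix K :: "complex vec set set"
  assume K: "\<forall>U\<in>K. U \<subseteq> carrier_vec n \<and> algebraic_set n (carrier_vec n - U)"
  then show "\<Union>K \<subseteq> carrier_vec n"
    by blast
  obtain F where F: "\<And>U. U \<in> K \<Longrightarrow> (\<forall>f\<in>F U. polyfun n f) \<and> carrier_vec n - U = zero_locus n (F U)"
    using K unfolding algebraic_set_def by metis
  have "x \<in> carrier_vec n - \<Union>K \<longleftrightarrow> x \<in> zero_locus n (\<Union>U\<in>K. F U)" for x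
  proof -
    have "x \<in> carrier_vec n - U \<longleftrightarrow> x \<in> zero_locus n (F U)" if "U \<in> K" for U
      using F that by blast
    then show ?thesis
      unfolding zero_locus_def by auto
  qed
  then have "carrier_vec n - \<Union>K = zero_locus n (\<Union>U\<in>K. F U)"
    by blast
  moreover have "\<forall>f\<in>(\<Union>U\<in>K. F U). polyfun n f"
    using F by blast
  ultimately show "algebraic_set n (carrier_vec n - \<Union>K)"
    unfolding algebraic_set_def by blast
qed

lemma topspace_zariski [simp]: "topspace (zariski n) = carrier_vec n"
proof -
  have "openin (zariski n) (carrier_vec n)"
  proof -
    have "polyfun n (\<lambda>_. 1)"
      unfolding polyfun_def by (rule exI[of _ "{\<lambda>_. 0}"], rule exI[of _ "\<lambda>_. 1"]) simp
    then have "algebraic_set n {}"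
      unfolding algebraic_set_def by (intro exI[of _ "{\<lambda>_. 1}"]) (auto simp: zero_locus_def)
    then show ?thesis
      by (simp add: zariski_def topology_inverse'[OF istopology_zariski])
  qed
  then show ?thesis
    unfolding topspace_def
    by (auto simp: zariski_def topology_inverse'[OF istopology_zariski])
qed

lemma closedin_zariski: "closedin (zariski n) S \<longleftrightarrow> algebraic_set n S"
proof
  assume "closedin (zariski n) S"
  then have "S \<subseteq> carrier_vec n" "algebraic_set n (carrier_vec n - (carrier_vec n - S))"
    by (auto simp: closedin_def zariski_def topology_inverse'[OF istopology_zariski]
        topspace_zariski[unfolded zariski_def])
  then show "algebraic_set n S"
    by (simp add: double_diff)
next
  assume S: "algebraic_set n S"
  then have "S \<subseteq> carrier_vec n"
    by (auto simp: algebraic_set_def zero_locus_def)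
  with S show "closedin (zariski n) S"
    by (simp add: closedin_def zariski_def topology_inverse'[OF istopology_zariski]
        topspace_zariski[unfolded zariski_def] double_diff)
qed

section \<open>Dimension\<close>

definition irreducible_closedin :: "'a topology \<Rightarrow> 'a set \<Rightarrow> bool" where
  "irreducible_closedin T S \<longleftrightarrow> closedin T S \<and> S \<noteq> {} \<and>
     (\<forall>A B. closedin T A \<and> closedin T B \<and> S = A \<union> B \<longrightarrow> S = A \<or> S = B)"

text \<open>Krull dimension: the supremum of the lengths \<open>k\<close> of chains
  \<open>C 0 \<subset> C 1 \<subset> \<dots> \<subset> C k\<close> of irreducible closed subsets.\<close>

definition krull_dim :: "'a topology \<Rightarrow> enat" where
  "krull_dim T = Sup {enat k | k. \<exists>C :: nat \<Rightarrow> 'a set.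
     (\<forall>i\<le>k. irreducible_closedin T (C i)) \<and> (\<forall>i<k. C i \<subset> C (Suc i))}"

section \<open>Representations and covariants\<close>

abbreviation GL :: "nat \<Rightarrow> complex mat monoid" where
  "GL n \<equiv> units_of (ring_mat TYPE(complex) n ())"

definition representation ::
    "('g, 'b) monoid_scheme \<Rightarrow> nat \<Rightarrow> ('g \<Rightarrow> complex mat) \<Rightarrow> bool" where
  "representation G n \<rho> \<longleftrightarrow> \<rho> \<in> hom G (GL n)"

definition faithful_representation ::
    "('g, 'b) monoid_scheme \<Rightarrow> nat \<Rightarrow> ('g \<Rightarrow> complex mat) \<Rightarrow> bool" where
  "faithful_representation G n \<rho> \<longleftrightarrow> representation G n \<rho> \<and> inj_on \<rho> (carrier G)"

text \<open>\<open>covariant G m \<rho> k \<sigma> \<phi>\<close>: \<open>\<phi>\<close> is a covariant from \<open>carrier_vec m\<close>, acted on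
  through \<open>\<rho>\<close>, to \<open>carrier_vec k\<close>, acted on through \<open>\<sigma>\<close>.\<close>

definition covariant :: "('g, 'b) monoid_scheme \<Rightarrow> nat \<Rightarrow> ('g \<Rightarrow> complex mat) \<Rightarrow>
    nat \<Rightarrow> ('g \<Rightarrow> complex mat) \<Rightarrow> (complex vec \<Rightarrow> complex vec) \<Rightarrow> bool" where
  "covariant G m \<rho> k \<sigma> \<phi> \<longleftrightarrow>
     representation G m \<rho> \<and> representation G k \<sigma> \<and> polymap m k \<phi> \<and>
     (\<forall>g\<in>carrier G. \<forall>x\<in>carrier_vec m. \<phi> (\<rho> g *\<^sub>v x) = \<sigma> g *\<^sub>v \<phi> x)"

definition faithful_covariant :: "('g, 'b) monoid_scheme \<Rightarrow> nat \<Rightarrow> ('g \<Rightarrow> complex mat) \<Rightarrow>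
    nat \<Rightarrow> ('g \<Rightarrow> complex mat) \<Rightarrow> (complex vec \<Rightarrow> complex vec) \<Rightarrow> bool" where
  "faithful_covariant G m \<rho> k \<sigma> \<phi> \<longleftrightarrow> covariant G m \<rho> k \<sigma> \<phi> \<and>
     (\<forall>g\<in>carrier G. (\<forall>y \<in> \<phi> ` carrier_vec m. \<sigma> g *\<^sub>v y = y) \<longrightarrow> g = \<one>\<^bsub>G\<^esub>)"

definition image_closure :: "nat \<Rightarrow> nat \<Rightarrow> (complex vec \<Rightarrow> complex vec) \<Rightarrow> complex vec set" where
  "image_closure m k \<phi> = zariski k closure_of (\<phi> ` carrier_vec m)"

definition dominant :: "nat \<Rightarrow> nat \<Rightarrow> (complex vec \<Rightarrow> complex vec) \<Rightarrow> bool" where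
  "dominant m k \<phi> \<longleftrightarrow> image_closure m k \<phi> = carrier_vec k"

definition map_dim :: "nat \<Rightarrow> nat \<Rightarrow> (complex vec \<Rightarrow> complex vec) \<Rightarrow> enat" where
  "map_dim m k \<phi> = krull_dim (subtopology (zariski k) (image_closure m k \<phi>))"

text \<open>An infimum in \<^typ>\<open>enat\<close> of a nonempty set is a minimum. Every module is
  isomorphic to a coordinate space \<open>carrier_vec m\<close>, so nothing is lost by letting
  only these occur.\<close>

definition covdim :: "('g, 'b) monoid_scheme \<Rightarrow> enat" where
  "covdim G = Inf {map_dim m k \<phi> | m \<rho> k \<sigma> \<phi>. faithful_covariant G m \<rho> k \<sigma> \<phi>}"

end

theory Submission
  imports Defs "HOL-Computational_Algebra.Polynomial"
begin

text \<open>
  Let \<open>p\<close> be a prime dividing all invariant factors of \<open>G\<close>. The elements killed by \<open>p\<close> form a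
  subgroup isomorphic to \<open>(\<int>/p)\<^sup>n\<close>. A faithful covariant \<open>\<phi> : V \<rightarrow> W\<close> provides semi-invariants
  \<open>L\<^sub>i\<close> on \<open>W\<close>, not vanishing on the image of \<open>\<phi>\<close>, whose characters form a basis of the dual of that
  subgroup. Composing with an equivariant polynomial map \<open>\<psi>\<close> from \<open>\<complex>\<^sup>n\<close> with its standard
  action of \<open>(\<mu>\<^sub>p)\<^sup>n\<close> to \<open>V\<close> yields nonzero polynomials \<open>F\<^sub>i = L\<^sub>i \<circ> \<phi> \<circ> \<psi>\<close> all of whose exponent
  vectors are congruent to the \<open>i\<close>-th unit vector modulo \<open>p\<close>. Their leading exponents thus form a
  nonsingular matrix, so the \<open>F\<^sub>i\<close> are algebraically independent. The same holds for
  \<open>F\<^sub>1, \<dots>, F\<^sub>j\<close> after setting the variables beyond the \<open>j\<close>-th to \<open>1\<close>. The closures of the images of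
  these coordinate subspaces form a chain of length \<open>n\<close> in the closure of \<open>\<phi>(V)\<close>, which is
  strict because \<open>\<complex>\<^sup>j\<close> has no dense image in \<open>\<complex>\<^sup>j\<^sup>+\<^sup>1\<close>.
\<close>

section \<open>Polynomial functions\<close>

text \<open>The zero values from \<open>n\<close> on make the set finite and let distinct elements
  stand for distinct monomials.\<close>

definition box :: "nat \<Rightarrow> nat \<Rightarrow> (nat \<Rightarrow> nat) set" where
  "box n d = {a. (\<forall>i<n. a i \<le> d) \<and> (\<forall>i\<ge>n. a i = 0)}"

text \<open>Bounding each exponent separately, rather than the total degree, gives exactly
  \<open>Suc d ^ n\<close> monomials, and the bounds still add under multiplication.\<close>

definition polyfun_le :: "nat \<Rightarrow> nat \<Rightarrow> (complex vec \<Rightarrow> complex) \<Rightarrow> bool" where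
  "polyfun_le n d f \<longleftrightarrow>
     (\<exists>c. \<forall>x\<in>carrier_vec n. f x = (\<Sum>a\<in>box n d. c a * (\<Prod>i<n. x $ i ^ a i)))"

lemma bij_betw_box: "bij_betw (\<lambda>g i. if i < n then g i else 0) (PiE {..<n} (\<lambda>_. {..d})) (box n d)"
proof (rule bij_betwI[where g = "\<lambda>a. restrict a {..<n}"])
  show "(\<lambda>g i. if i < n then g i else 0) \<in> ({..<n} \<rightarrow>\<^sub>E {..d}) \<rightarrow> box n d"
    by (auto simp: box_def PiE_def Pi_def)
  show "(\<lambda>a. restrict a {..<n}) \<in> box n d \<rightarrow> ({..<n} \<rightarrow>\<^sub>E {..d})"
    by (auto simp: box_def)
  show "restrict (\<lambda>i. if i < n then g i else 0) {..<n} = g" if "g \<in> {..<n} \<rightarrow>\<^sub>E {..d}" for g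
    using that by (auto simp: fun_eq_iff PiE_def extensional_def)
  show "(\<lambda>i. if i < n then restrict a {..<n} i else 0) = a" if "a \<in> box n d" for a
    using that by (auto simp: fun_eq_iff box_def)
qed

lemma card_box: "card (box n d) = Suc d ^ n"
  using bij_betw_same_card[OF bij_betw_box[of n d]] by (simp add: card_PiE)

lemma finite_box [simp]: "finite (box n d)"
  using card_box[of n d] by (metis card.infinite power_not_zero nat.distinct(1))

lemma polyfun_le_cong:
  assumes "polyfun_le n d f" "\<And>x. x \<in> carrier_vec n \<Longrightarrow> f x = g x"
  shows "polyfun_le n d g"
  using assms unfolding polyfun_le_def by auto

lemma polyfun_le_monomial:
  assumes "\<And>i. i < n \<Longrightarrow> a i \<le> d"
  shows "polyfun_le n d (\<lambda>x. c * (\<Prod>i<n. x $ i ^ a i))"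
  unfolding polyfun_le_def
proof (intro exI ballI)
  fix x :: "complex vec"
  let ?a = "\<lambda>i. if i < n then a i else 0"
  have *: "?a \<in> box n d"
    using assms by (auto simp: box_def)
  show "c * (\<Prod>i<n. x $ i ^ a i) =
      (\<Sum>b\<in>box n d. (if b = ?a then c else 0) * (\<Prod>i<n. x $ i ^ b i))"
  proof -
    have "(\<Sum>b\<in>box n d. (if b = ?a then c else 0) * (\<Prod>i<n. x $ i ^ b i)) =
        (\<Sum>b\<in>box n d. if b = ?a then c * (\<Prod>i<n. x $ i ^ b i) else 0)"
      by (rule sum.cong) auto
    also have "\<dots> = c * (\<Prod>i<n. x $ i ^ ?a i)"
      by (subst sum.delta) (use * in auto)
    also have "\<dots> = c * (\<Prod>i<n. x $ i ^ a i)"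
      by simp
    finally show ?thesis ..
  qed
qed

lemma polyfun_le_sum:
  assumes "\<And>i. i \<in> I \<Longrightarrow> polyfun_le n d (f i)"
  shows "polyfun_le n d (\<lambda>x. \<Sum>i\<in>I. f i x)"
proof -
  obtain c where c: "\<And>i x. i \<in> I \<Longrightarrow> x \<in> carrier_vec n \<Longrightarrow>
      f i x = (\<Sum>a\<in>box n d. c i a * (\<Prod>i<n. x $ i ^ a i))"
    using assms unfolding polyfun_le_def by metis
  have "(\<Sum>i\<in>I. f i x) = (\<Sum>a\<in>box n d. (\<Sum>i\<in>I. c i a) * (\<Prod>i<n. x $ i ^ a i))"
    if "x \<in> carrier_vec n" for x
  proof -
    have "(\<Sum>i\<in>I. f i x) = (\<Sum>i\<in>I. \<Sum>a\<in>box n d. c i a * (\<Prod>i<n. x $ i ^ a i))"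
      by (rule sum.cong) (simp_all add: c that)
    also have "\<dots> = (\<Sum>a\<in>box n d. \<Sum>i\<in>I. c i a * (\<Prod>i<n. x $ i ^ a i))"
      by (rule sum.swap)
    finally show ?thesis
      by (simp only: sum_distrib_right)
  qed
  then show ?thesis
    unfolding polyfun_le_def by (intro exI[of _ "\<lambda>a. \<Sum>i\<in>I. c i a"] ballI)
qed

lemma polyfun_le_mono:
  assumes "polyfun_le n d f" "d \<le> e"
  shows "polyfun_le n e f"
proof -
  obtain c where c: "\<And>x. x \<in> carrier_vec n \<Longrightarrow> f x = (\<Sum>a\<in>box n d. c a * (\<Prod>i<n. x $ i ^ a i))"
    using assms(1) by (auto simp: polyfun_le_def)
  have "polyfun_le n e (\<lambda>x. \<Sum>a\<in>box n d. c a * (\<Prod>i<n. x $ i ^ a i))"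
    using assms(2) by (intro polyfun_le_sum polyfun_le_monomial) (auto simp: box_def intro: order_trans)
  then show ?thesis
    by (rule polyfun_le_cong) (simp add: c)
qed

lemma polyfun_le_mult:
  assumes "polyfun_le n d f" "polyfun_le n e g"
  shows "polyfun_le n (d + e) (\<lambda>x. f x * g x)"
proof -
  obtain c where c: "\<And>x. x \<in> carrier_vec n \<Longrightarrow> f x = (\<Sum>a\<in>box n d. c a * (\<Prod>i<n. x $ i ^ a i))"
    using assms(1) by (auto simp: polyfun_le_def)
  obtain k where k: "\<And>x. x \<in> carrier_vec n \<Longrightarrow> g x = (\<Sum>a\<in>box n e. k a * (\<Prod>i<n. x $ i ^ a i))"
    using assms(2) by (auto simp: polyfun_le_def)
  have "polyfun_le n (d + e)
      (\<lambda>x. \<Sum>a\<in>box n d. \<Sum>b\<in>box n e. (c a * k b) * (\<Prod>i<n. x $ i ^ (a i + b i)))"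
    by (intro polyfun_le_sum polyfun_le_monomial) (auto simp: box_def intro: add_mono)
  then show ?thesis
    by (rule polyfun_le_cong)
      (auto simp: c k sum_product power_add prod.distrib mult_ac intro!: sum.cong)
qed

lemma polyfun_le_const: "polyfun_le n d (\<lambda>_. c)"
  using polyfun_le_monomial[of n "\<lambda>_. 0" d c] by simp

lemma polyfun_le_power: "polyfun_le n d f \<Longrightarrow> polyfun_le n (k * d) (\<lambda>x. f x ^ k)"
  by (induction k) (simp_all add: polyfun_le_const polyfun_le_mult)

lemma polyfun_le_prod:
  assumes "finite I" "\<And>i. i \<in> I \<Longrightarrow> polyfun_le n (d i) (f i)"
  shows "polyfun_le n (\<Sum>i\<in>I. d i) (\<lambda>x. \<Prod>i\<in>I. f i x)"
  using assms by (induction I) (simp_all add: polyfun_le_const polyfun_le_mult)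

lemma polyfun_le_imp_polyfun: "polyfun_le n d f \<Longrightarrow> polyfun n f"
  unfolding polyfun_le_def polyfun_def using finite_box by blast

lemma polyfun_imp_polyfun_le:
  assumes "polyfun n f"
  obtains d where "polyfun_le n d f"
proof -
  obtain A c where A: "finite A" "\<And>x. x \<in> carrier_vec n \<Longrightarrow> f x = (\<Sum>a\<in>A. c a * (\<Prod>i<n. x $ i ^ a i))"
    using assms by (auto simp: polyfun_def)
  \<comment> \<open>If \<open>A\<close> is empty or \<open>n = 0\<close>, the maximum is
    unspecified, but then there is no exponent to bound.\<close>
  have "a i \<le> Max ((\<lambda>(a, i). a i) ` (A \<times> {..<n}))" if "a \<in> A" "i < n" for a i
    using that A(1) by (intro Max_ge) (auto intro!: image_eqI[of _ _ "(a, i)"])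
  then have "polyfun_le n (Max ((\<lambda>(a, i). a i) ` (A \<times> {..<n})))
      (\<lambda>x. \<Sum>a\<in>A. c a * (\<Prod>i<n. x $ i ^ a i))"
    by (intro polyfun_le_sum polyfun_le_monomial)
  then have "polyfun_le n (Max ((\<lambda>(a, i). a i) ` (A \<times> {..<n}))) f"
    by (rule polyfun_le_cong) (simp add: A(2))
  then show ?thesis
    by (rule that)
qed

section \<open>Closure properties of polynomial functions and maps\<close>

lemma polyfun_cong:
  "polyfun n f \<Longrightarrow> (\<And>x. x \<in> carrier_vec n \<Longrightarrow> f x = g x) \<Longrightarrow> polyfun n g"
  unfolding polyfun_def by auto

lemma polyfun_const [intro, simp]: "polyfun n (\<lambda>_. c)"
  using polyfun_le_const polyfun_le_imp_polyfun by blast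

lemma polyfun_power [intro]: "polyfun n f \<Longrightarrow> polyfun n (\<lambda>x. f x ^ k)"
  by (induction k) (simp_all add: polyfun_mult)

lemma polyfun_prod:
  "finite I \<Longrightarrow> (\<And>i. i \<in> I \<Longrightarrow> polyfun n (f i)) \<Longrightarrow> polyfun n (\<lambda>x. \<Prod>i\<in>I. f i x)"
  by (induction I rule: finite_induct) (simp_all add: polyfun_mult)

lemma polyfun_add:
  assumes "polyfun n f" "polyfun n g"
  shows "polyfun n (\<lambda>x. f x + g x)"
proof -
  obtain d e where d: "polyfun_le n d f" "polyfun_le n e g"
    using assms by (meson polyfun_imp_polyfun_le)
  \<comment> \<open>The two summands become a family indexed by \<open>bool\<close> with a common
    bound, so that \<open>polyfun_le_sum\<close> applies.\<close>
  have "polyfun_le n (max d e) (\<lambda>x. if b then f x else g x)" for b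
    using polyfun_le_mono[OF d(1), of "max d e"] polyfun_le_mono[OF d(2), of "max d e"] by (cases b) auto
  then have "polyfun_le n (max d e) (\<lambda>x. \<Sum>b\<in>UNIV. if b then f x else g x)"
    by (intro polyfun_le_sum)
  then show ?thesis
    by (intro polyfun_le_imp_polyfun[of n "max d e"]) (simp add: UNIV_bool add.commute)
qed

lemma polyfun_sum:
  "(\<And>i. i \<in> I \<Longrightarrow> polyfun n (f i)) \<Longrightarrow> polyfun n (\<lambda>x. \<Sum>i\<in>I. f i x)"
  by (induction I rule: infinite_finite_induct) (simp_all add: polyfun_add)

lemma polyfun_coord:
  assumes i: "i < n"
  shows "polyfun n (\<lambda>x. x $ i)"
proof (rule polyfun_cong)
  show "polyfun n (\<lambda>x. 1 * (\<Prod>j<n. x $ j ^ (if j = i then 1 else 0)))"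
    by (rule polyfun_le_imp_polyfun[OF polyfun_le_monomial[where d = 1]]) auto
next
  fix x :: "complex vec"
  have "(\<Prod>j<n. x $ j ^ (if j = i then 1 else 0)) = (\<Prod>j<n. if j = i then x $ j else 1)"
    by (rule prod.cong) auto
  then show "1 * (\<Prod>j<n. x $ j ^ (if j = i then 1 else 0)) = x $ i"
    using i by (simp add: prod.delta)
qed

lemma polyfun_compose:
  assumes "polyfun k P" "polymap n k f"
  shows "polyfun n (\<lambda>x. P (f x))"
proof -
  obtain A c where A: "finite A" "\<And>x. x \<in> carrier_vec k \<Longrightarrow> P x = (\<Sum>a\<in>A. c a * (\<Prod>i<k. x $ i ^ a i))"
    using assms(1) by (auto simp: polyfun_def)
  have "polyfun n (\<lambda>x. \<Sum>a\<in>A. c a * (\<Prod>i<k. f x $ i ^ a i))"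
    using assms(2) by (intro polyfun_sum polyfun_mult polyfun_prod polyfun_power) (auto simp: polymap_def)
  then show ?thesis
    by (rule polyfun_cong) (use assms(2) in \<open>auto simp: polymap_def Pi_def A\<close>)
qed

lemma polymapI:
  "(\<And>x. x \<in> carrier_vec m \<Longrightarrow> f x \<in> carrier_vec k) \<Longrightarrow>
   (\<And>i. i < k \<Longrightarrow> polyfun m (\<lambda>x. f x $ i)) \<Longrightarrow> polymap m k f"
  by (auto simp: polymap_def)

lemma polymap_carrier: "polymap m k f \<Longrightarrow> x \<in> carrier_vec m \<Longrightarrow> f x \<in> carrier_vec k"
  by (auto simp: polymap_def)

lemma polymap_polyfun: "polymap m k f \<Longrightarrow> i < k \<Longrightarrow> polyfun m (\<lambda>x. f x $ i)"
  by (auto simp: polymap_def)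

lemma polymap_vec: "(\<And>i. i < k \<Longrightarrow> polyfun m (f i)) \<Longrightarrow> polymap m k (\<lambda>x. vec k (\<lambda>i. f i x))"
  by (auto intro!: polymapI)

lemma polymap_comp:
  assumes "polymap n m f" "polymap m k g"
  shows "polymap n k (\<lambda>x. g (f x))"
  using assms polyfun_compose[OF polymap_polyfun[OF assms(2)] assms(1)]
  by (auto intro!: polymapI dest: polymap_carrier)

lemma polymap_mult_mat_vec:
  assumes "A \<in> carrier_mat k m"
  shows "polymap m k (\<lambda>x. A *\<^sub>v x)"
proof (rule polymapI)
  show "polyfun m (\<lambda>x. (A *\<^sub>v x) $ i)" if "i < k" for i
  proof (rule polyfun_cong)
    show "polyfun m (\<lambda>x. \<Sum>j<m. A $$ (i, j) * x $ j)"
      by (intro polyfun_sum polyfun_mult polyfun_const polyfun_coord) auto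
  qed (use assms that in \<open>auto simp: scalar_prod_def atLeast0LessThan intro!: sum.cong\<close>)
qed (use assms in auto)

section \<open>Restriction to curves and irreducibility of affine space\<close>

lemma polyfun_univariate:
  fixes q :: "nat \<Rightarrow> complex poly"
  assumes "polyfun n P"
  shows "\<exists>r. \<forall>s. P (vec n (\<lambda>i. poly (q i) s)) = poly r s"
proof -
  obtain A c where A: "finite A" "\<And>x. x \<in> carrier_vec n \<Longrightarrow> P x = (\<Sum>a\<in>A. c a * (\<Prod>i<n. x $ i ^ a i))"
    using assms by (auto simp: polyfun_def)
  show ?thesis
    by (rule exI[of _ "\<Sum>a\<in>A. [:c a:] * (\<Prod>i<n. q i ^ a i)"])
      (simp add: A poly_sum poly_prod poly_power)
qed

text \<open>On the line through a point where \<open>P\<close> is nonzero and a point where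
  \<open>Q\<close> is nonzero, both restrict to nonzero polynomials in one variable, and these have
  a nonzero product.\<close>

lemma polyfun_mult_eq_0:
  assumes "polyfun n P" "polyfun n Q" "\<And>x. x \<in> carrier_vec n \<Longrightarrow> P x * Q x = 0"
  shows "(\<forall>x\<in>carrier_vec n. P x = 0) \<or> (\<forall>x\<in>carrier_vec n. Q x = 0)"
proof (rule ccontr)
  assume "\<not> ?thesis"
  then obtain x y where xy: "x \<in> carrier_vec n" "P x \<noteq> 0" "y \<in> carrier_vec n" "Q y \<noteq> 0"
    by blast
  let ?l = "\<lambda>s. vec n (\<lambda>i. poly [:x $ i, y $ i - x $ i:] s)"
  have l: "?l 0 = x" "?l 1 = y"
    using xy by auto
  obtain p where p: "\<And>s. P (?l s) = poly p s"
    using polyfun_univariate[OF assms(1), of "\<lambda>i. [:x $ i, y $ i - x $ i:]"] by blast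
  obtain q where q: "\<And>s. Q (?l s) = poly q s"
    using polyfun_univariate[OF assms(2), of "\<lambda>i. [:x $ i, y $ i - x $ i:]"] by blast
  have "poly (p * q) s = 0" for s
    using assms(3)[of "?l s"] by (simp add: p[symmetric] q[symmetric])
  then have "p * q = 0"
    using poly_all_0_iff_0 by blast
  then have "poly p 0 = 0 \<or> poly q 1 = 0"
    by auto
  then show False
    using xy p[of 0] q[of 1] l by simp
qed

lemma polyfun_common_nonzero:
  assumes "finite I" "\<And>i. i \<in> I \<Longrightarrow> polyfun n (f i)"
    and "\<And>i. i \<in> I \<Longrightarrow> \<exists>x\<in>carrier_vec n. f i x \<noteq> 0"
  shows "\<exists>x\<in>carrier_vec n. \<forall>i\<in>I. f i x \<noteq> 0"
proof -
  have "\<exists>x\<in>carrier_vec n. (\<Prod>i\<in>I. f i x) \<noteq> 0"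
    using assms
  proof (induction I rule: finite_induct)
    case empty
    then show ?case by (auto intro: exI[of _ "0\<^sub>v n"])
  next
    case (insert i I)
    then have "\<exists>x\<in>carrier_vec n. (\<Prod>i\<in>I. f i x) \<noteq> 0" "\<exists>x\<in>carrier_vec n. f i x \<noteq> 0"
      by auto
    moreover have "polyfun n (\<lambda>x. \<Prod>i\<in>I. f i x)" "polyfun n (f i)"
      using insert by (auto intro: polyfun_prod)
    ultimately have "\<exists>x\<in>carrier_vec n. f i x * (\<Prod>i\<in>I. f i x) \<noteq> 0"
      using polyfun_mult_eq_0 by blast
    then show ?case
      using insert by simp
  qed
  then show ?thesis
    using assms(1) by auto
qed

section \<open>Algebraic independence\<close>

text \<open>Only the summand of largest degree contributes to the coefficient in that degree, so
  nothing cancels it.\<close>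

lemma sum_poly_distinct_degrees:
  fixes q :: "'i \<Rightarrow> 'a::comm_ring_1 poly"
  assumes "finite A" "A \<noteq> {}" "\<And>a. a \<in> A \<Longrightarrow> q a \<noteq> 0" "inj_on (\<lambda>a. degree (q a)) A"
  shows "(\<Sum>a\<in>A. q a) \<noteq> 0 \<and> (\<exists>a\<in>A. degree (\<Sum>a\<in>A. q a) = degree (q a))"
proof -
  obtain a where a: "a \<in> A" "\<And>b. b \<in> A \<Longrightarrow> degree (q b) \<le> degree (q a)"
    using Max_in[of "(\<lambda>a. degree (q a)) ` A"] Max_ge[of "(\<lambda>a. degree (q a)) ` A"] assms(1,2)
    by (smt (verit, best) finite_imageI image_iff image_is_empty)
  have less: "degree (q b) < degree (q a)" if "b \<in> A - {a}" for b
    using a that assms(4) by (metis DiffD1 DiffD2 inj_onD le_neq_implies_less singletonI)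
  have "coeff (\<Sum>b\<in>A - {a}. q b) (degree (q a)) = 0"
    unfolding coeff_sum by (rule sum.neutral) (use less coeff_eq_0 in blast)
  then have "coeff (\<Sum>b\<in>A. q b) (degree (q a)) = lead_coeff (q a)"
    using assms(1) a(1) by (simp add: sum.remove)
  then have nz: "coeff (\<Sum>b\<in>A. q b) (degree (q a)) \<noteq> 0"
    using assms(3) a(1) by simp
  then have "degree (\<Sum>b\<in>A. q b) \<ge> degree (q a)"
    using le_degree by blast
  moreover have "degree (\<Sum>b\<in>A. q b) \<le> degree (q a)"
    using a(2) assms(1) by (intro degree_sum_le) auto
  ultimately show ?thesis
    using nz a(1) by (metis coeff_0 le_antisym)
qed

text \<open>Weights are taken of the form \<open>s ^ i\<close>, so that every vector to be avoided rules out
  only the roots of one polynomial.\<close>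

lemma separating_weights:
  fixes U :: "(nat \<Rightarrow> int) set"
  assumes "finite U" "\<And>u. u \<in> U \<Longrightarrow> \<exists>i<n. u i \<noteq> 0"
  shows "\<exists>w :: nat \<Rightarrow> nat. \<forall>u\<in>U. (\<Sum>i<n. int (w i) * u i) \<noteq> 0"
proof -
  define q :: "(nat \<Rightarrow> int) \<Rightarrow> int poly" where "q = (\<lambda>u. \<Sum>i<n. Polynomial.monom (u i) i)"
  have "coeff (q u) i = u i" if "i < n" for u i
    using that by (simp add: q_def coeff_sum if_distrib cong: if_cong)
  then have "q u \<noteq> 0" if "u \<in> U" for u
    using assms(2)[OF that] by (metis coeff_0)
  then have "finite (\<Union>u\<in>U. {s. poly (q u) s = 0})"
    using assms(1) by (simp add: poly_roots_finite)
  then have "infinite (range int - (\<Union>u\<in>U. {s. poly (q u) s = 0}))"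
    by (intro Diff_infinite_finite) (auto simp: finite_image_iff)
  then obtain t where "t \<in> range int - (\<Union>u\<in>U. {s. poly (q u) s = 0})"
    using infinite_imp_nonempty by blast
  then obtain s where s: "\<And>u. u \<in> U \<Longrightarrow> poly (q u) (int s) \<noteq> 0"
    by blast
  have "(\<Sum>i<n. int (s ^ i) * u i) = poly (q u) (int s)" for u
    by (simp add: q_def poly_sum poly_monom mult.commute)
  with s show ?thesis
    by (intro exI[of _ "\<lambda>i. s ^ i"]) simp
qed

text \<open>This is the degree of the monomial with exponents \<open>a\<close> along the curve with
  coordinates \<open>s ^ w i\<close>.\<close>

definition weight :: "nat \<Rightarrow> (nat \<Rightarrow> nat) \<Rightarrow> (nat \<Rightarrow> nat) \<Rightarrow> nat" where
  "weight n w a = (\<Sum>i<n. w i * a i)"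

text \<open>Fixing the values from \<open>n\<close> on makes a monomial in \<open>n\<close>
  variables determine its exponent function.\<close>

definition exponents :: "nat \<Rightarrow> (nat \<Rightarrow> nat) set" where
  "exponents n = {a. \<forall>i\<ge>n. a i = 0}"

lemma box_subset_exponents: "box n d \<subseteq> exponents n"
  by (auto simp: box_def exponents_def)

lemma weight_separates:
  assumes "\<forall>u\<in>U. (\<Sum>i<n. int (w i) * u i) \<noteq> 0" "(\<lambda>i. int (a i) - int (b i)) \<in> U"
  shows "weight n w a \<noteq> weight n w b"
proof
  assume "weight n w a = weight n w b"
  moreover have "(\<Sum>i<n. int (w i) * (int (a i) - int (b i))) = int (weight n w a) - int (weight n w b)"
    by (simp add: weight_def right_diff_distrib sum_subtractf)
  ultimately have "(\<Sum>i<n. int (w i) * (int (a i) - int (b i))) = 0"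
    by simp
  with bspec[OF assms] show False
    by simp
qed

lemma exponents_neq:
  assumes "a \<in> exponents n" "b \<in> exponents n" "a \<noteq> b"
  shows "\<exists>i<n. a i \<noteq> b i"
proof -
  obtain i where i: "a i \<noteq> b i"
    using assms(3) by blast
  with assms(1,2) have "i < n"
    by (cases "i < n") (simp_all add: exponents_def)
  with i show ?thesis
    by blast
qed

lemma monomial_weight_curve:
  fixes s :: "'a::comm_semiring_1"
  shows "(\<Prod>i<n. vec n (\<lambda>i. s ^ w i) $ i ^ a i) = s ^ weight n w a"
  by (simp add: weight_def power_sum power_mult)

text \<open>Distinct weights turn the terms of \<open>f\<close> into terms of distinct degrees in
  \<open>s\<close>. The degree of the restriction is therefore the weight of an exponent of
  \<open>f\<close>, which serves as its leading exponent.\<close>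

lemma monomials_on_curve:
  fixes c :: "(nat \<Rightarrow> nat) \<Rightarrow> complex"
  assumes "finite A" "A \<noteq> {}" "\<And>a. a \<in> A \<Longrightarrow> c a \<noteq> 0" "inj_on (weight n w) A"
    and "\<And>x. x \<in> carrier_vec n \<Longrightarrow> f x = (\<Sum>a\<in>A. c a * (\<Prod>i<n. x $ i ^ a i))"
  shows "\<exists>q. q \<noteq> 0 \<and> (\<exists>a\<in>A. degree q = weight n w a) \<and>
    (\<forall>s. f (vec n (\<lambda>i. s ^ w i)) = poly q s)"
proof -
  let ?q = "\<Sum>a\<in>A. Polynomial.monom (c a) (weight n w a)"
  have "?q \<noteq> 0 \<and> (\<exists>a\<in>A. degree ?q = degree (Polynomial.monom (c a) (weight n w a)))"
    using assms(1-4)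
    by (intro sum_poly_distinct_degrees) (auto simp: degree_monom_eq inj_on_def)
  moreover have "f (vec n (\<lambda>i. s ^ w i)) = poly ?q s" for s
    by (simp add: assms(5) monomial_weight_curve poly_sum poly_monom del: index_vec)
  ultimately show ?thesis
    using assms(3) by (intro exI[of _ ?q]) (auto simp: degree_monom_eq)
qed

text \<open>Monomial functions are linearly independent: weights separating the exponents with
  nonzero coefficient would give a curve on which the zero function restricts to a nonzero
  polynomial.\<close>

lemma polynomial_coefficients_zero:
  assumes "finite A" "A \<subseteq> exponents n"
    and "\<And>x. x \<in> carrier_vec n \<Longrightarrow> (\<Sum>a\<in>A. c a * (\<Prod>i<n. x $ i ^ a i)) = (0 :: complex)"
    and "a \<in> A"
  shows "c a = 0"
proof (rule ccontr)
  assume "c a \<noteq> 0"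
  define B where "B = {a \<in> A. c a \<noteq> 0}"
  have B: "finite B" "B \<noteq> {}" "B \<subseteq> exponents n"
    using assms(1,2,4) \<open>c a \<noteq> 0\<close> by (auto simp: B_def)
  have "\<exists>w. \<forall>u\<in>(\<lambda>(a, b) i. int (a i) - int (b i)) ` {(a, b). a \<in> B \<and> b \<in> B \<and> a \<noteq> b}.
      (\<Sum>i<n. int (w i) * u i) \<noteq> 0"
  proof (rule separating_weights)
    have "{(a, b). a \<in> B \<and> b \<in> B \<and> a \<noteq> b} \<subseteq> B \<times> B"
      by auto
    then show "finite ((\<lambda>(a, b) i. int (a i) - int (b i)) ` {(a, b). a \<in> B \<and> b \<in> B \<and> a \<noteq> b})"
      using B by (meson finite_SigmaI finite_imageI finite_subset)
    fix u
    assume "u \<in> (\<lambda>(a, b) i. int (a i) - int (b i)) ` {(a, b). a \<in> B \<and> b \<in> B \<and> a \<noteq> b}"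
    then show "\<exists>i<n. u i \<noteq> 0"
      using exponents_neq B(3) by (auto simp: subset_iff)
  qed
  then obtain w where w: "\<forall>u\<in>(\<lambda>(a, b) i. int (a i) - int (b i)) ` {(a, b). a \<in> B \<and> b \<in> B \<and> a \<noteq> b}.
      (\<Sum>i<n. int (w i) * u i) \<noteq> 0"
    by blast
  have inj: "inj_on (weight n w) B"
    using weight_separates[OF w] by (auto simp: inj_on_def image_iff)
  have sumB: "(\<Sum>a\<in>A. c a * (\<Prod>i<n. x $ i ^ a i)) = (\<Sum>a\<in>B. c a * (\<Prod>i<n. x $ i ^ a i))" for x
    unfolding B_def using assms(1) by (intro sum.mono_neutral_right) auto
  have "\<exists>q :: complex poly. q \<noteq> 0 \<and> (\<exists>a\<in>B. degree q = weight n w a) \<and> (\<forall>s. 0 = poly q s)"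
  proof (rule monomials_on_curve[of B c n w "\<lambda>_. 0"])
    show "0 = (\<Sum>a\<in>B. c a * (\<Prod>i<n. x $ i ^ a i))" if "x \<in> carrier_vec n" for x
      using assms(3)[OF that] sumB by simp
    show "c a \<noteq> 0" if "a \<in> B" for a
      using that by (simp add: B_def)
  qed (use B inj in auto)
  then show False
    using poly_all_0_iff_0 by (metis (no_types))
qed

lemma polyfun_normal_form:
  assumes "polyfun n f"
  obtains A c where "finite A" "A \<subseteq> exponents n" "\<And>a. a \<in> A \<Longrightarrow> c a \<noteq> (0 :: complex)"
    "\<And>x. x \<in> carrier_vec n \<Longrightarrow> f x = (\<Sum>a\<in>A. c a * (\<Prod>i<n. x $ i ^ a i))"
proof -
  obtain d where "polyfun_le n d f"
    using assms polyfun_imp_polyfun_le by blast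
  then obtain c where c: "\<And>x. x \<in> carrier_vec n \<Longrightarrow> f x = (\<Sum>a\<in>box n d. c a * (\<Prod>i<n. x $ i ^ a i))"
    by (auto simp: polyfun_le_def)
  have "f x = (\<Sum>a\<in>{a \<in> box n d. c a \<noteq> 0}. c a * (\<Prod>i<n. x $ i ^ a i))" if "x \<in> carrier_vec n" for x
    unfolding c[OF that] by (rule sum.mono_neutral_right) auto
  moreover have "{a \<in> box n d. c a \<noteq> 0} \<subseteq> exponents n"
    using box_subset_exponents by blast
  ultimately show ?thesis
    by (intro that[of "{a \<in> box n d. c a \<noteq> 0}" c]) auto
qed

text \<open>For the image of a polynomial map this says that its components are algebraically
  independent.\<close>

definition zariski_dense :: "nat \<Rightarrow> complex vec set \<Rightarrow> bool" where
  "zariski_dense r T \<longleftrightarrow>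
     (\<forall>P. polyfun r P \<and> (\<forall>y\<in>T. P y = 0) \<longrightarrow> (\<forall>y\<in>carrier_vec r. P y = 0))"

lemma zariski_denseD:
  "zariski_dense r T \<Longrightarrow> polyfun r P \<Longrightarrow> (\<And>y. y \<in> T \<Longrightarrow> P y = 0) \<Longrightarrow> y \<in> carrier_vec r \<Longrightarrow> P y = 0"
  unfolding zariski_dense_def by blast

section \<open>Dense images and the number of variables\<close>

lemma homogeneous_system_nontrivial_solution:
  fixes a :: "'j \<Rightarrow> 'i \<Rightarrow> 'a::field"
  assumes "finite J" "finite I" "card J < card I"
  shows "\<exists>x. (\<exists>i\<in>I. x i \<noteq> 0) \<and> (\<forall>j\<in>J. (\<Sum>i\<in>I. a j i * x i) = 0)"
  using assms
proof (induction J arbitrary: I a rule: finite_induct)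
  case empty
  then show ?case
    by (intro exI[of _ "\<lambda>_. 1"]) (auto simp: card_gt_0_iff)
next
  case (insert k J)
  show ?case
  proof (cases "\<forall>i\<in>I. a k i = 0")
    case True
    have "card J < card I"
      using insert.prems insert.hyps by simp
    from insert.IH[OF insert.prems(1) this, of a] obtain x
      where x: "\<exists>i\<in>I. x i \<noteq> 0" "\<forall>j\<in>J. (\<Sum>i\<in>I. a j i * x i) = 0"
      by (elim exE conjE)
    show ?thesis
      by (rule exI[of _ x]) (use x True in simp)
  next
    case False
    then obtain m where m: "m \<in> I" "a k m \<noteq> 0"
      by blast
    let ?I = "I - {m}"
    have "card J < card ?I"
      using insert m by simp
    \<comment> \<open>Equation \<open>k\<close> is solved for the unknown \<open>m\<close> and
      substituted into the others, which leaves one equation and one unknown fewer.\<close>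
    then obtain x where x: "\<exists>i\<in>?I. x i \<noteq> 0"
        "\<forall>j\<in>J. (\<Sum>i\<in>?I. (a j i - a j m * a k i / a k m) * x i) = 0"
      using insert.IH[of ?I "\<lambda>j i. a j i - a j m * a k i / a k m"] insert.prems by auto
    define y where "y = x(m := - (\<Sum>i\<in>?I. a k i * x i) / a k m)"
    have sumI: "(\<Sum>i\<in>I. a j i * y i) = a j m * y m + (\<Sum>i\<in>?I. a j i * x i)" for j
      using m(1) insert.prems by (subst sum.remove[of I m]) (auto simp: y_def intro!: sum.cong)
    have "(\<Sum>i\<in>I. a k i * y i) = 0"
      unfolding sumI using m(2) by (simp add: y_def)
    moreover have "(\<Sum>i\<in>I. a j i * y i) = 0" if "j \<in> J" for j
    proof -
      have "(\<Sum>i\<in>?I. (a j i - a j m * a k i / a k m) * x i) =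
          (\<Sum>i\<in>?I. a j i * x i) - a j m / a k m * (\<Sum>i\<in>?I. a k i * x i)"
        unfolding sum_distrib_left sum_subtractf[symmetric]
        by (rule sum.cong) (auto simp: algebra_simps)
      also have "\<dots> = (\<Sum>i\<in>I. a j i * y i)"
        unfolding sumI by (simp add: y_def)
      finally show ?thesis
        using x(2) that by simp
    qed
    moreover have "\<exists>i\<in>I. y i \<noteq> 0"
      using x(1) by (auto simp: y_def)
    ultimately show ?thesis
      by blast
  qed
qed

text \<open>Counting: the \<open>N ^ r\<close> monomials with exponents below \<open>N\<close> in the components of the map
  lie in a space of dimension \<open>O(N ^ n)\<close>.\<close>

lemma zariski_dense_image_le:
  assumes f: "polymap n r f" and dense: "zariski_dense r (f ` carrier_vec n)"
  shows "r \<le> n"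
proof (rule ccontr)
  assume "\<not> r \<le> n"
  then have "n < r" by simp
  have "\<exists>e. \<forall>i<r. polyfun_le n (e i) (\<lambda>x. f x $ i)"
  proof (intro choice allI)
    show "\<exists>d. i < r \<longrightarrow> polyfun_le n d (\<lambda>x. f x $ i)" for i
      using polymap_polyfun[OF f, of i] by (cases "i < r") (auto elim: polyfun_imp_polyfun_le)
  qed
  then obtain e where e: "\<And>i. i < r \<Longrightarrow> polyfun_le n (e i) (\<lambda>x. f x $ i)"
    by blast
  define d where "d = (\<Sum>i<r. e i)"
  \<comment> \<open>With this \<open>N\<close>, the number of monomials available in the domain is
    at most \<open>(Suc d * N) ^ n = N * N ^ n\<close>, which is less than
    \<open>Suc N ^ Suc n\<close> and hence less than the number of monomials in the \<open>r\<close>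
    components.\<close>
  define N where "N = Suc d ^ n"
  have N: "N > 0"
    by (simp add: N_def)
  have "card (box n (N * d)) < card (box r N)"
  proof -
    have "Suc (N * d) ^ n \<le> (Suc d * N) ^ n"
      using N by (intro power_mono) auto
    also have "\<dots> = N * N ^ n"
      by (simp only: power_mult_distrib flip: N_def)
    also have "\<dots> < Suc N ^ Suc n"
      using power_strict_mono[of N "Suc N" "Suc n"] by simp
    also have "\<dots> \<le> Suc N ^ r"
      using \<open>n < r\<close> by (intro power_increasing) auto
    finally show ?thesis
      by (simp add: card_box)
  qed
  have "polyfun_le n (N * d) (\<lambda>x. \<Prod>i<r. f x $ i ^ a i)" if "a \<in> box r N" for a
  proof (rule polyfun_le_mono)
    show "polyfun_le n (\<Sum>i<r. a i * e i) (\<lambda>x. \<Prod>i<r. f x $ i ^ a i)"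
      using e by (intro polyfun_le_prod polyfun_le_power) auto
    show "(\<Sum>i<r. a i * e i) \<le> N * d"
      using that unfolding d_def sum_distrib_left by (intro sum_mono mult_mono) (auto simp: box_def)
  qed
  then have "\<forall>a\<in>box r N. \<exists>k. \<forall>x\<in>carrier_vec n.
      (\<Prod>i<r. f x $ i ^ a i) = (\<Sum>b\<in>box n (N * d). k b * (\<Prod>i<n. x $ i ^ b i))"
    unfolding polyfun_le_def by blast
  from bchoice[OF this] obtain k where k: "\<And>a x. a \<in> box r N \<Longrightarrow> x \<in> carrier_vec n \<Longrightarrow>
      (\<Prod>i<r. f x $ i ^ a i) = (\<Sum>b\<in>box n (N * d). k a b * (\<Prod>i<n. x $ i ^ b i))"
    by blast
  \<comment> \<open>More monomials than dimensions: some nontrivial combination of the monomials in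
    the components of \<open>f\<close> is zero, and its coefficients are those of a polynomial
    \<open>P\<close> vanishing on the image.\<close>
  obtain c where c: "\<exists>a\<in>box r N. c a \<noteq> 0"
      "\<And>b. b \<in> box n (N * d) \<Longrightarrow> (\<Sum>a\<in>box r N. k a b * c a) = 0"
    using homogeneous_system_nontrivial_solution[OF finite_box finite_box
        \<open>card (box n (N * d)) < card (box r N)\<close>, of "\<lambda>b a. k a b"] by blast
  define P where "P = (\<lambda>y :: complex vec. \<Sum>a\<in>box r N. c a * (\<Prod>i<r. y $ i ^ a i))"
  have "polyfun r P"
    unfolding P_def polyfun_def using finite_box by blast
  moreover have "P (f x) = 0" if x: "x \<in> carrier_vec n" for x
  proof -
    have "P (f x) = (\<Sum>a\<in>box r N. \<Sum>b\<in>box n (N * d). k a b * c a * (\<Prod>i<n. x $ i ^ b i))"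
      unfolding P_def by (rule sum.cong) (auto simp: k x sum_distrib_left mult_ac)
    also have "\<dots> = (\<Sum>b\<in>box n (N * d). (\<Sum>a\<in>box r N. k a b * c a) * (\<Prod>i<n. x $ i ^ b i))"
      by (subst sum.swap) (simp add: sum_distrib_right)
    finally show ?thesis
      by (simp add: c(2))
  qed
  ultimately have P0: "P y = 0" if "y \<in> carrier_vec r" for y
    using zariski_denseD[OF dense] that by blast
  have "c a = 0" if "a \<in> box r N" for a
    by (rule polynomial_coefficients_zero[OF finite_box box_subset_exponents _ that])
      (use P0 in \<open>simp add: P_def\<close>)
  then show False
    using c(1) by blast
qed

section \<open>Semi-invariants under scalings of the coordinates\<close>

definition scale_coord :: "nat \<Rightarrow> complex \<Rightarrow> complex vec \<Rightarrow> complex vec" where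
  "scale_coord l z x = vec (dim_vec x) (\<lambda>i. if i = l then z * x $ i else x $ i)"

lemma scale_coord_carrier [simp]: "x \<in> carrier_vec n \<Longrightarrow> scale_coord l z x \<in> carrier_vec n"
  by (simp add: scale_coord_def)

lemma scale_coord_index [simp]:
  "i < dim_vec x \<Longrightarrow> scale_coord l z x $ i = (if i = l then z * x $ i else x $ i)"
  by (simp add: scale_coord_def)

text \<open>Scaling coordinate \<open>l\<close> by \<open>w\<close> multiplies the monomial with
  exponents \<open>a\<close> by \<open>w ^ a l\<close>; comparison of coefficients forces this
  factor to be \<open>z\<close> on every monomial that occurs.\<close>

lemma semi_invariant_exponents:
  assumes "finite A" "A \<subseteq> exponents n" "\<And>a. a \<in> A \<Longrightarrow> c a \<noteq> 0"
    and f: "\<And>x. x \<in> carrier_vec n \<Longrightarrow> f x = (\<Sum>a\<in>A. c a * (\<Prod>i<n. x $ i ^ a i))"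
    and semi: "\<And>x. x \<in> carrier_vec n \<Longrightarrow> f (scale_coord l w x) = z * f x"
    and "a \<in> A" "l < n"
  shows "w ^ a l = z"
proof -
  have mon: "(\<Prod>i<n. scale_coord l w x $ i ^ b i) = w ^ b l * (\<Prod>i<n. x $ i ^ b i)"
    if x: "x \<in> carrier_vec n" for x b
  proof -
    have "(\<Prod>i<n. scale_coord l w x $ i ^ b i) = (\<Prod>i<n. (if i = l then w ^ b i else 1) * x $ i ^ b i)"
      by (rule prod.cong) (use x in \<open>auto simp: power_mult_distrib\<close>)
    also have "\<dots> = w ^ b l * (\<Prod>i<n. x $ i ^ b i)"
      using \<open>l < n\<close> by (simp add: prod.distrib)
    finally show ?thesis .
  qed
  have "(\<Sum>b\<in>A. (c b * (w ^ b l - z)) * (\<Prod>i<n. x $ i ^ b i)) = 0" if x: "x \<in> carrier_vec n" for x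
  proof -
    have "(\<Sum>b\<in>A. (c b * (w ^ b l - z)) * (\<Prod>i<n. x $ i ^ b i)) =
        f (scale_coord l w x) - z * f x"
      unfolding f[OF x] f[OF scale_coord_carrier[OF x]] mon[OF x] sum_distrib_left
        sum_subtractf[symmetric]
      by (rule sum.cong) (auto simp: algebra_simps)
    then show ?thesis
      by (simp add: semi x)
  qed
  from polynomial_coefficients_zero[OF assms(1,2) this assms(6)]
  have "c a * (w ^ a l - z) = 0"
    .
  then show ?thesis
    using assms(3,6) by auto
qed

text \<open>Infinite descent: modulo \<open>p\<close> the equations read \<open>v = 0\<close>, so
  \<open>v\<close> is divisible by \<open>p\<close>, and the quotient satisfies the same equations.
  Hence every power of \<open>p\<close> divides \<open>v\<close>.\<close>

lemma congruent_to_identity_nonsingular: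
  fixes D :: "nat \<Rightarrow> nat \<Rightarrow> int"
  assumes "1 < p" and D: "\<And>i l. i < n \<Longrightarrow> l < n \<Longrightarrow> int p dvd D i l - (if i = l then 1 else 0)"
    and v: "\<And>l. l < n \<Longrightarrow> (\<Sum>i<n. v i * D i l) = 0"
    and "i < n"
  shows "v i = 0"
proof -
  have "\<forall>i<n. int p ^ k dvd v i" for k
  proof (induction k)
    case (Suc k)
    define u where "u = (\<lambda>i. v i div int p ^ k)"
    have u: "v i = int p ^ k * u i" if "i < n" for i
      using Suc that by (simp add: u_def)
    have "int p dvd u l" if l: "l < n" for l
    proof -
      have "int p ^ k * (\<Sum>i<n. u i * D i l) = (\<Sum>i<n. v i * D i l)"
        unfolding sum_distrib_left by (rule sum.cong) (auto simp: u)
      then have "(\<Sum>i<n. u i * D i l) = 0"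
        using v[OF l] \<open>1 < p\<close> by simp
      moreover have "(\<Sum>i<n. u i * (if i = l then 1 else 0)) = u l"
        using l by (simp add: if_distrib cong: if_cong)
      ultimately have "u l = - (\<Sum>i<n. u i * (D i l - (if i = l then 1 else 0)))"
        by (simp only: right_diff_distrib sum_subtractf)
      moreover have "int p dvd - (\<Sum>i<n. u i * (D i l - (if i = l then 1 else 0)))"
        using D l by (intro dvd_sum dvd_mult iffD2[OF dvd_minus_iff]) auto
      ultimately show ?thesis
        by (rule ssubst)
    qed
    then show ?case
      by (auto simp: u mult.commute[of "int p"] intro!: mult_dvd_mono)
  qed simp
  \<comment> \<open>The exponent is chosen so that the power of \<open>p\<close> exceeds the
    absolute value of \<open>v i\<close>.\<close>
  then have dvd: "int p ^ nat \<bar>v i\<bar> dvd v i"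
    using \<open>i < n\<close> by blast
  show ?thesis
  proof (rule ccontr)
    assume "v i \<noteq> 0"
    then have "int p ^ nat \<bar>v i\<bar> \<le> \<bar>v i\<bar>"
      using dvd_imp_le_int[OF _ dvd] by simp
    moreover have "nat \<bar>v i\<bar> < p ^ nat \<bar>v i\<bar>"
      using \<open>1 < p\<close> power_gt_expt[of p] by simp
    ultimately show False
      by (metis nat_less_iff abs_ge_zero of_nat_power not_le)
  qed
qed

lemma root_of_unity_power_eq:
  assumes w: "\<And>k. w ^ k = (1 :: complex) \<longleftrightarrow> p dvd k" and "1 < p"
    and "w ^ k = (if b then w else 1)"
  shows "int p dvd int k - (if b then 1 else 0)"
proof (cases b)
  case True
  have "w \<noteq> 1"
    using w[of 1] \<open>1 < p\<close> by simp
  then have "k \<noteq> 0"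
    using assms(3) True by (intro notI) simp
  then obtain m where "k = Suc m"
    using not0_implies_Suc by blast
  moreover have "w \<noteq> 0"
    using w[of p] \<open>1 < p\<close> by (intro notI) (simp add: zero_power)
  ultimately show ?thesis
    using assms(3) True w[of m] by simp
next
  case False
  then show ?thesis
    using assms(3) w[of k] by simp
qed

text \<open>Leading exponents along a generic monomial curve form a matrix congruent to the identity
  modulo \<open>p\<close>; being nonsingular, it keeps the leading terms of distinct monomials in the
  components of \<open>F\<close> apart.\<close>

lemma semi_invariant_map_dense:
  assumes w: "\<And>k. w ^ k = (1 :: complex) \<longleftrightarrow> p dvd k" and "1 < p"
    and F: "polymap n n F"
    and semi: "\<And>i l x. i < n \<Longrightarrow> l < n \<Longrightarrow> x \<in> carrier_vec n \<Longrightarrow>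
      F (scale_coord l w x) $ i = (if i = l then w else 1) * F x $ i"
    and nz: "\<And>i. i < n \<Longrightarrow> \<exists>x\<in>carrier_vec n. F x $ i \<noteq> 0"
  shows "zariski_dense n (F ` carrier_vec n)"
  unfolding zariski_dense_def
proof (intro allI impI, elim conjE, rule ccontr)
  fix P
  assume P: "polyfun n P" "\<forall>y\<in>F ` carrier_vec n. P y = 0" and "\<not> (\<forall>y\<in>carrier_vec n. P y = 0)"
  obtain B c where B: "finite B" "B \<subseteq> exponents n" "\<And>a. a \<in> B \<Longrightarrow> c a \<noteq> 0"
    "\<And>x. x \<in> carrier_vec n \<Longrightarrow> P x = (\<Sum>a\<in>B. c a * (\<Prod>i<n. x $ i ^ a i))"
    by (rule polyfun_normal_form[OF P(1)]) (rule that)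
  have "B \<noteq> {}"
    using \<open>\<not> (\<forall>y\<in>carrier_vec n. P y = 0)\<close> B(4) by auto
  have "\<exists>S k. finite S \<and> S \<subseteq> exponents n \<and> (\<forall>a\<in>S. k a \<noteq> 0) \<and>
      (\<forall>x\<in>carrier_vec n. F x $ i = (\<Sum>a\<in>S. k a * (\<Prod>j<n. x $ j ^ a j)))" if "i < n" for i
    by (rule polyfun_normal_form[OF polymap_polyfun[OF F that]]) blast
  then have "\<forall>i\<in>{..<n}. \<exists>S k. finite S \<and> S \<subseteq> exponents n \<and> (\<forall>a\<in>S. k a \<noteq> 0) \<and>
      (\<forall>x\<in>carrier_vec n. F x $ i = (\<Sum>a\<in>S. k a * (\<Prod>j<n. x $ j ^ a j)))"
    by simp
  from bchoice[OF this] obtain S where "\<forall>i\<in>{..<n}. \<exists>k. finite (S i) \<and> S i \<subseteq> exponents n \<and>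
      (\<forall>a\<in>S i. k a \<noteq> 0) \<and>
      (\<forall>x\<in>carrier_vec n. F x $ i = (\<Sum>a\<in>S i. k a * (\<Prod>j<n. x $ j ^ a j)))"
    by (elim exE)
  from bchoice[OF this] obtain k where k: "\<forall>i\<in>{..<n}. finite (S i) \<and> S i \<subseteq> exponents n \<and>
      (\<forall>a\<in>S i. k i a \<noteq> 0) \<and>
      (\<forall>x\<in>carrier_vec n. F x $ i = (\<Sum>a\<in>S i. k i a * (\<Prod>j<n. x $ j ^ a j)))"
    by (elim exE)
  have S: "finite (S i)" "S i \<subseteq> exponents n" "a \<in> S i \<Longrightarrow> k i a \<noteq> 0"
    "x \<in> carrier_vec n \<Longrightarrow> F x $ i = (\<Sum>a\<in>S i. k i a * (\<Prod>j<n. x $ j ^ a j))"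
    if "i < n" for i a x
    using bspec[OF k, of i] that by simp_all
  have S_ne: "S i \<noteq> {}" if "i < n" for i
  proof
    assume "S i = {}"
    then have "F x $ i = 0" if "x \<in> carrier_vec n" for x
      using S(4)[OF \<open>i < n\<close> that] by simp
    then show False
      using nz[OF that] by blast
  qed
  have S_mod: "int p dvd int (a l) - (if i = l then 1 else 0)" if "i < n" "l < n" "a \<in> S i" for i l a
  proof (rule root_of_unity_power_eq[OF w \<open>1 < p\<close>])
    show "w ^ a l = (if i = l then w else 1)"
      by (rule semi_invariant_exponents[OF S(1,2,3,4) semi]) (rule that | assumption)+
  qed
  \<comment> \<open>These are the vectors that a generic weight must not annihilate. Those in
    \<open>U1\<close> separate the exponents of one component of \<open>F\<close>, so that each
    component has a leading exponent on the curve. Those in \<open>U2\<close> separate the monomials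
    of \<open>P\<close> after substitution of the leading exponents; as these depend on the weight
    still to be chosen, every selection \<open>D\<close> of one exponent per component is taken into
    account.\<close>
  define U1 where "U1 = (\<lambda>(a, b) l. int (a l) - int (b l)) `
    {(a, b) \<in> (\<Union>i<n. S i \<times> S i). a \<noteq> b}"
  define U2 where "U2 = (\<lambda>((a, b), D) l. \<Sum>i<n. (int (a i) - int (b i)) * int (D i l)) `
    ({(a, b) \<in> B \<times> B. a \<noteq> b} \<times> (\<Pi>\<^sub>E i\<in>{..<n}. S i))"
  have "finite {(a, b) \<in> (\<Union>i<n. S i \<times> S i). a \<noteq> b}"
    by (rule finite_subset[of _ "\<Union>i<n. S i \<times> S i"]) (use S(1) in auto)
  then have "finite U1"
    unfolding U1_def by (rule finite_imageI)
  have "finite {(a, b) \<in> B \<times> B. a \<noteq> b}"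
    by (rule finite_subset[of _ "B \<times> B"]) (use B(1) in auto)
  then have "finite U2"
    unfolding U2_def using S(1) by (intro finite_imageI finite_cartesian_product finite_PiE) auto
  have "\<exists>W :: nat \<Rightarrow> nat. \<forall>u\<in>U1 \<union> U2. (\<Sum>i<n. int (W i) * u i) \<noteq> 0"
  proof (rule separating_weights)
    fix u
    assume "u \<in> U1 \<union> U2"
    then consider "u \<in> U1" | "u \<in> U2" by blast
    then show "\<exists>l<n. u l \<noteq> 0"
    proof cases
      case 1
      then obtain i a b where "i < n" "a \<in> S i" "b \<in> S i" "a \<noteq> b" "u = (\<lambda>l. int (a l) - int (b l))"
        by (auto simp: U1_def)
      then show ?thesis
        using exponents_neq[of a n b] S(2) by auto
    next
      case 2
      then obtain a b D where *: "a \<in> B" "b \<in> B" "a \<noteq> b" "D \<in> (\<Pi>\<^sub>E i\<in>{..<n}. S i)"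
        "u = (\<lambda>l. \<Sum>i<n. (int (a i) - int (b i)) * int (D i l))"
        by (auto simp: U2_def)
      obtain m where m: "m < n" "a m \<noteq> b m"
        using exponents_neq[of a n b] B(2) * by blast
      have D: "int p dvd int (D i l) - (if i = l then 1 else 0)" if "i < n" "l < n" for i l
        using S_mod[OF that] PiE_mem[OF *(4), of i] that by simp
      show ?thesis
      proof (rule ccontr)
        \<comment> \<open>Otherwise the nonzero row vector of the differences
          \<open>a i - b i\<close> would be annihilated by \<open>D\<close>, which is the identity
          modulo \<open>p\<close>.\<close>
        assume "\<not> ?thesis"
        then have "(\<Sum>i<n. (int (a i) - int (b i)) * int (D i l)) = 0" if "l < n" for l
          using that *(5) by simp
        from congruent_to_identity_nonsingular[OF \<open>1 < p\<close> D this m(1)]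
        have "int (a m) - int (b m) = 0"
          .
        with m show False by simp
      qed
    qed
  qed (use \<open>finite U1\<close> \<open>finite U2\<close> in simp)
  then obtain W :: "nat \<Rightarrow> nat" where W1: "\<forall>u\<in>U1. (\<Sum>i<n. int (W i) * u i) \<noteq> 0"
    and W2: "\<forall>u\<in>U2. (\<Sum>i<n. int (W i) * u i) \<noteq> 0"
    by blast
  have "inj_on (weight n W) (S i)" if "i < n" for i
  proof (rule inj_onI, rule ccontr)
    fix a b
    assume ab: "a \<in> S i" "b \<in> S i" "weight n W a = weight n W b" "a \<noteq> b"
    then have "(\<lambda>l. int (a l) - int (b l)) \<in> U1"
      unfolding U1_def using that by (intro image_eqI[of _ _ "(a, b)"]) auto
    with weight_separates[OF W1] ab(3) show False
      by blast
  qed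
  then have "\<exists>q. q \<noteq> 0 \<and> (\<exists>a\<in>S i. degree q = weight n W a) \<and>
      (\<forall>s. F (vec n (\<lambda>j. s ^ W j)) $ i = poly q s)" if "i < n" for i
    using that S S_ne by (intro monomials_on_curve[where f = "\<lambda>x. F x $ i" and c = "k i"]) auto
  then obtain q D where q: "\<And>i. i < n \<Longrightarrow> q i \<noteq> 0" "\<And>i. i < n \<Longrightarrow> D i \<in> S i"
    "\<And>i. i < n \<Longrightarrow> degree (q i) = weight n W (D i)"
    "\<And>i s. i < n \<Longrightarrow> F (vec n (\<lambda>j. s ^ W j)) $ i = poly (q i) s"
    by metis
  let ?t = "\<lambda>a. smult (c a) (\<Prod>i<n. q i ^ a i)"
  have t0: "?t a \<noteq> 0" if "a \<in> B" for a
    using that q(1) B(3) by simp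
  \<comment> \<open>The leading exponent of the product is the row vector \<open>a\<close> times the
    matrix \<open>D\<close> of leading exponents.\<close>
  have deg: "degree (?t a) = weight n W (\<lambda>l. \<Sum>i<n. a i * D i l)" if "a \<in> B" for a
  proof -
    have "degree (?t a) = degree (\<Prod>i<n. q i ^ a i)"
      using B(3)[OF that] by simp
    also have "\<dots> = (\<Sum>i<n. degree (q i ^ a i))"
      by (rule degree_prod_sum_eq) (use q(1) in simp)
    also have "\<dots> = (\<Sum>i<n. a i * weight n W (D i))"
      using q(1,3) by (intro sum.cong) (simp_all add: degree_power_eq)
    also have "\<dots> = (\<Sum>i<n. \<Sum>l<n. W l * (a i * D i l))"
      by (simp add: weight_def sum_distrib_left mult_ac)
    also have "\<dots> = (\<Sum>l<n. \<Sum>i<n. W l * (a i * D i l))"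
      by (rule sum.swap)
    finally show ?thesis
      by (simp add: weight_def sum_distrib_left)
  qed
  have "inj_on (\<lambda>a. degree (?t a)) B"
  proof (rule inj_onI, rule ccontr)
    fix a b
    assume ab: "a \<in> B" "b \<in> B" "degree (?t a) = degree (?t b)" "a \<noteq> b"
    \<comment> \<open>Restricting \<open>D\<close> to indices below \<open>n\<close> puts it into
      the extensional function space over which \<open>U2\<close> ranges.\<close>
    have "(\<lambda>l. int (\<Sum>i<n. a i * D i l) - int (\<Sum>i<n. b i * D i l)) =
        (\<lambda>l. \<Sum>i<n. (int (a i) - int (b i)) * int (restrict D {..<n} i l))"
      by (simp add: fun_eq_iff left_diff_distrib sum_subtractf)
    also have "\<dots> \<in> U2"
      unfolding U2_def using ab q(2)
      by (intro image_eqI[of _ _ "((a, b), restrict D {..<n})"]) auto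
    finally have "weight n W (\<lambda>l. \<Sum>i<n. a i * D i l) \<noteq> weight n W (\<lambda>l. \<Sum>i<n. b i * D i l)"
      by (rule weight_separates[OF W2])
    then show False
      using ab(3) unfolding deg[OF ab(1)] deg[OF ab(2)] by (rule notE)
  qed
  from sum_poly_distinct_degrees[where q = ?t, OF B(1) \<open>B \<noteq> {}\<close> t0 this]
  have "(\<Sum>a\<in>B. ?t a) \<noteq> 0" ..
  moreover have "poly (\<Sum>a\<in>B. ?t a) s = 0" for s
  proof -
    let ?x = "vec n (\<lambda>j. s ^ W j)"
    have "F ?x \<in> carrier_vec n"
      using polymap_carrier[OF F] by simp
    then have "P (F ?x) = poly (\<Sum>a\<in>B. ?t a) s"
      by (simp add: B(4) q(4) poly_sum poly_prod poly_power)
    then show ?thesis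
      using P(2) by simp
  qed
  ultimately show False
    using poly_all_0_iff_0 by blast
qed

section \<open>Krull dimension and dense images\<close>

text \<open>Some \<open>r\<close> polynomial functions are algebraically independent on
  \<open>Z\<close>. This replaces the statement that the function field of an irreducible
  \<open>Z\<close> has transcendence degree at least \<open>r\<close>.\<close>

definition has_dense_image :: "nat \<Rightarrow> nat \<Rightarrow> complex vec set \<Rightarrow> bool" where
  "has_dense_image k r Z \<longleftrightarrow> (\<exists>f. polymap k r f \<and> zariski_dense r (f ` Z))"

lemma polyfun_last_variable:
  assumes "polyfun (Suc r) P"
  obtains d Q where "\<And>j. polyfun r (Q j)"
    "\<And>x z. x \<in> carrier_vec r \<Longrightarrow> P (vec (Suc r) (\<lambda>i. if i < r then x $ i else z)) = (\<Sum>j\<le>d. Q j x * z ^ j)"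
proof -
  obtain d c where c: "\<And>x. x \<in> carrier_vec (Suc r) \<Longrightarrow>
      P x = (\<Sum>a\<in>box (Suc r) d. c a * (\<Prod>i<Suc r. x $ i ^ a i))"
    using assms polyfun_imp_polyfun_le unfolding polyfun_le_def by metis
  define Q where "Q = (\<lambda>j (x :: complex vec).
    \<Sum>a\<in>{a \<in> box (Suc r) d. a r = j}. c a * (\<Prod>i<r. x $ i ^ a i))"
  have "polyfun r (Q j)" for j
    unfolding Q_def polyfun_def by (intro exI[of _ "{a \<in> box (Suc r) d. a r = j}"] exI[of _ c]) simp
  moreover have "P (vec (Suc r) (\<lambda>i. if i < r then x $ i else z)) = (\<Sum>j\<le>d. Q j x * z ^ j)"
    if x: "x \<in> carrier_vec r" for x z
  proof -
    have "P (vec (Suc r) (\<lambda>i. if i < r then x $ i else z)) =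
        (\<Sum>a\<in>box (Suc r) d. c a * (\<Prod>i<r. x $ i ^ a i) * z ^ a r)"
      unfolding c[OF vec_carrier] by (rule sum.cong) simp_all
    also have "\<dots> = (\<Sum>j\<le>d. \<Sum>a\<in>{a \<in> box (Suc r) d. a r = j}.
        c a * (\<Prod>i<r. x $ i ^ a i) * z ^ a r)"
      by (rule sum.group[symmetric, OF finite_box finite_atMost]) (auto simp: box_def)
    also have "\<dots> = (\<Sum>j\<le>d. Q j x * z ^ j)"
      unfolding Q_def sum_distrib_right by (intro sum.cong) auto
    finally show ?thesis .
  qed
  ultimately show ?thesis
    using that by blast
qed

text \<open>The zero loci of \<open>f\<close> and \<open>g\<close> cut out two closed subsets
  covering \<open>Z\<close>; in other words, the vanishing ideal of an irreducible set is
  prime.\<close>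

lemma irreducible_zariskiD:
  assumes "irreducible_closedin (zariski k) Z" "polyfun k f" "polyfun k g"
    and "\<And>x. x \<in> Z \<Longrightarrow> f x * g x = 0"
  shows "(\<forall>x\<in>Z. f x = 0) \<or> (\<forall>x\<in>Z. g x = 0)"
proof -
  have Z: "closedin (zariski k) Z"
    using assms(1) by (simp add: irreducible_closedin_def)
  have "closedin (zariski k) (zero_locus k {h})" if "polyfun k h" for h
    unfolding closedin_zariski algebraic_set_def using that by blast
  then have "closedin (zariski k) (Z \<inter> zero_locus k {f})" "closedin (zariski k) (Z \<inter> zero_locus k {g})"
    using Z assms(2,3) by auto
  moreover have "Z = (Z \<inter> zero_locus k {f}) \<union> (Z \<inter> zero_locus k {g})"
    using closedin_subset[OF Z] assms(4) by (auto simp: zero_locus_def)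
  ultimately have "Z = Z \<inter> zero_locus k {f} \<or> Z = Z \<inter> zero_locus k {g}"
    using assms(1) unfolding irreducible_closedin_def by blast
  then show ?thesis
    by (auto simp: zero_locus_def)
qed

lemma closedin_zariski_separate:
  assumes "closedin (zariski k) Z" "x \<in> carrier_vec k" "x \<notin> Z"
  obtains g where "polyfun k g" "\<And>y. y \<in> Z \<Longrightarrow> g y = 0" "g x \<noteq> 0"
  using assms unfolding closedin_zariski algebraic_set_def zero_locus_def by blast

text \<open>If \<open>g\<close> vanishes on \<open>Z\<close> but not on \<open>Z'\<close>, a relation \<open>P(f, g) = 0\<close> on \<open>Z'\<close> may be divided by a power
  of \<open>g\<close> until it restricts to a nontrivial relation between the components of \<open>f\<close> on \<open>Z\<close>.\<close>

lemma has_dense_image_strict: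
  assumes Z: "closedin (zariski k) Z" and Z': "irreducible_closedin (zariski k) Z'"
    and "Z \<subset> Z'" and "has_dense_image k r Z"
  shows "has_dense_image k (Suc r) Z'"
proof -
  obtain f where f: "polymap k r f" "zariski_dense r (f ` Z)"
    using assms(4) by (auto simp: has_dense_image_def)
  have sub: "Z' \<subseteq> carrier_vec k"
    using Z' closedin_subset[of "zariski k" Z'] by (simp add: irreducible_closedin_def)
  obtain x0 where x0: "x0 \<in> Z'" "x0 \<notin> Z"
    using assms(3) by blast
  obtain g where g: "polyfun k g" "\<And>y. y \<in> Z \<Longrightarrow> g y = 0" "g x0 \<noteq> 0"
    using closedin_zariski_separate[OF Z, of x0] x0 sub by blast
  \<comment> \<open>The new independent function is \<open>g\<close>, which vanishes on the smaller
    set only.\<close>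
  define h where "h = (\<lambda>x. vec (Suc r) (\<lambda>i. if i < r then f x $ i else g x))"
  have "polymap k (Suc r) h"
    unfolding h_def
  proof (rule polymap_vec)
    show "polyfun k (\<lambda>x. if i < r then f x $ i else g x)" for i
      using polymap_polyfun[OF f(1), of i] g(1) by (cases "i < r") auto
  qed
  moreover have "zariski_dense (Suc r) (h ` Z')"
    unfolding zariski_dense_def
  proof (intro allI impI, elim conjE)
    fix P
    assume P: "polyfun (Suc r) P" "\<forall>y\<in>h ` Z'. P y = 0"
    obtain d Q where Q: "\<And>j. polyfun r (Q j)" and PQ: "\<And>x z. x \<in> carrier_vec r \<Longrightarrow>
        P (vec (Suc r) (\<lambda>i. if i < r then x $ i else z)) = (\<Sum>j\<le>d. Q j x * z ^ j)"
      using polyfun_last_variable[OF P(1)] by metis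
    have Qf: "polyfun k (\<lambda>x. Q j (f x))" for j
      using polyfun_compose[OF Q f(1)] .
    have rel: "(\<Sum>j\<le>d. Q j (f x) * g x ^ j) = 0" if "x \<in> Z'" for x
      using P(2) that PQ[of "f x" "g x"] polymap_carrier[OF f(1), of x] sub
      by (auto simp: h_def)
    have zero: "\<forall>x\<in>carrier_vec r. Q j x = 0" if "j \<le> d" for j
      using that
    proof (induction j rule: less_induct)
      case (less j)
      \<comment> \<open>The coefficients below \<open>j\<close> are zero by induction, so the
        relation is \<open>g ^ j\<close> times \<open>R\<close>. On \<open>Z'\<close> the factor
        \<open>g ^ j\<close> is not identically zero, because \<open>g x0\<close> is nonzero, and
        irreducibility leaves \<open>R = 0\<close> there.\<close>
      define R where "R = (\<lambda>x. \<Sum>i\<in>{j..d}. Q i (f x) * g x ^ (i - j))"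
      have pR: "polyfun k R"
        unfolding R_def by (intro polyfun_sum polyfun_mult Qf polyfun_power g(1))
      have "g x ^ j * R x = 0" if x: "x \<in> Z'" for x
      proof -
        have "(\<Sum>i\<le>d. Q i (f x) * g x ^ i) = (\<Sum>i\<in>{j..d}. Q i (f x) * g x ^ i)"
        proof (rule sum.mono_neutral_right)
          show "\<forall>i\<in>{..d} - {j..d}. Q i (f x) * g x ^ i = 0"
            using less polymap_carrier[OF f(1), of x] x sub by auto
        qed auto
        also have "\<dots> = g x ^ j * R x"
          unfolding R_def sum_distrib_left
          by (rule sum.cong) (auto simp: power_add[symmetric] mult.left_commute)
        finally show ?thesis
          using rel[OF x] by simp
      qed
      then have "(\<forall>x\<in>Z'. g x ^ j = 0) \<or> (\<forall>x\<in>Z'. R x = 0)"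
        using irreducible_zariskiD[OF Z' polyfun_power[OF g(1)] pR] by blast
      then have R0: "R x = 0" if "x \<in> Z" for x
        using x0 g(3) that assms(3) by auto
      have "Q j (f x) = 0" if x: "x \<in> Z" for x
      proof -
        \<comment> \<open>On \<open>Z\<close> only the term without a factor \<open>g\<close>
          survives.\<close>
        have "R x = (\<Sum>i\<in>{j..d}. if i = j then Q j (f x) else 0)"
          unfolding R_def by (rule sum.cong) (auto simp: g(2)[OF x])
        then show ?thesis
          using R0[OF x] less.prems by simp
      qed
      then show ?case
        using zariski_denseD[OF f(2) Q, of j] by blast
    qed
    show "\<forall>y\<in>carrier_vec (Suc r). P y = 0"
    proof
      fix y :: "complex vec"
      assume y: "y \<in> carrier_vec (Suc r)"
      have "y = vec (Suc r) (\<lambda>i. if i < r then vec r (\<lambda>i. y $ i) $ i else y $ r)"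
        using y by (auto simp: less_Suc_eq)
      then show "P y = 0"
        using PQ[of "vec r (\<lambda>i. y $ i)" "y $ r"] zero by simp
    qed
  qed
  ultimately show ?thesis
    by (auto simp: has_dense_image_def)
qed

section \<open>Closures of images and the dimension of affine space\<close>

lemma zariski_dense_mono: "zariski_dense r S \<Longrightarrow> S \<subseteq> T \<Longrightarrow> zariski_dense r T"
  unfolding zariski_dense_def by blast

lemma zariski_closure_vanish:
  assumes "polyfun k f" "\<And>x. x \<in> S \<Longrightarrow> f x = 0" "S \<subseteq> carrier_vec k" "x \<in> zariski k closure_of S"
  shows "f x = 0"
proof -
  have "closedin (zariski k) (zero_locus k {f})"
    unfolding closedin_zariski algebraic_set_def using assms(1) by blast
  moreover have "S \<subseteq> zero_locus k {f}"
    using assms(2,3) by (auto simp: zero_locus_def)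
  ultimately have "zariski k closure_of S \<subseteq> zero_locus k {f}"
    by (rule closure_of_minimal[rotated])
  then show ?thesis
    using assms(4) by (auto simp: zero_locus_def)
qed

lemma has_dense_image_closure:
  assumes f: "polymap k r f" "zariski_dense r (f ` (zariski k closure_of S))" and S: "S \<subseteq> carrier_vec k"
  shows "zariski_dense r (f ` S)"
  unfolding zariski_dense_def
proof (intro allI impI, elim conjE)
  fix P
  assume P: "polyfun r P" "\<forall>y\<in>f ` S. P y = 0"
  then have "\<forall>y\<in>f ` (zariski k closure_of S). P y = 0"
    using zariski_closure_vanish[OF polyfun_compose[OF P(1) f(1)] _ S] by auto
  then show "\<forall>y\<in>carrier_vec r. P y = 0"
    using f(2) P(1) unfolding zariski_dense_def by blast
qed

text \<open>If neither of two closed sets covering the closure contained the image, equations of the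
  two sets would pull back to nonzero polynomial functions on affine space with product
  zero.\<close>

lemma irreducible_closure_of_image:
  assumes f: "polymap m k f"
  shows "irreducible_closedin (zariski k) (zariski k closure_of (f ` carrier_vec m))"
    (is "irreducible_closedin _ ?Z")
  unfolding irreducible_closedin_def
proof (intro conjI allI impI)
  have img: "f ` carrier_vec m \<subseteq> carrier_vec k"
    using polymap_carrier[OF f] by auto
  then have subZ: "f ` carrier_vec m \<subseteq> ?Z"
    by (intro closure_of_subset) simp
  show "?Z \<noteq> {}"
    using subZ zero_carrier_vec[of m] by blast
  fix A B
  assume AB: "closedin (zariski k) A \<and> closedin (zariski k) B \<and> ?Z = A \<union> B"
  show "?Z = A \<or> ?Z = B"
  proof (rule ccontr)
    assume "\<not> ?thesis"
    then have "\<not> f ` carrier_vec m \<subseteq> A" "\<not> f ` carrier_vec m \<subseteq> B"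
      using AB closure_of_minimal[of "f ` carrier_vec m" _ "zariski k"] by blast+
    then obtain x y where xy: "x \<in> carrier_vec m" "f x \<notin> A" "y \<in> carrier_vec m" "f y \<notin> B"
      by blast
    obtain a where a: "polyfun k a" "\<And>z. z \<in> A \<Longrightarrow> a z = 0" "a (f x) \<noteq> 0"
      using closedin_zariski_separate[of k A "f x"] AB xy polymap_carrier[OF f] by metis
    obtain b where b: "polyfun k b" "\<And>z. z \<in> B \<Longrightarrow> b z = 0" "b (f y) \<noteq> 0"
      using closedin_zariski_separate[of k B "f y"] AB xy polymap_carrier[OF f] by metis
    have "a (f z) * b (f z) = 0" if "z \<in> carrier_vec m" for z
      using subZ AB that a(2) b(2) by fastforce
    then show False
      using polyfun_mult_eq_0[OF polyfun_compose[OF a(1) f] polyfun_compose[OF b(1) f]] xy a(3) b(3)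
      by blast
  qed
qed simp

lemma irreducible_closedin_subtopology:
  assumes "closedin U Y"
  shows "irreducible_closedin (subtopology U Y) Z \<longleftrightarrow> irreducible_closedin U Z \<and> Z \<subseteq> Y"
proof -
  have "closedin (subtopology U Y) A \<longleftrightarrow> A \<subseteq> Y \<and> closedin U A" for A
    using assms closedin_closed_subtopology by blast
  then show ?thesis
    unfolding irreducible_closedin_def by (simp only:) blast
qed

text \<open>Each strict inclusion in a chain adds one algebraically independent function, so a chain
  of length \<open>k\<close> yields \<open>k\<close> independent functions on affine
  \<open>n\<close>-space, which is impossible for \<open>k > n\<close>.\<close>

lemma krull_dim_affine_le: "krull_dim (zariski n) \<le> enat n"
  unfolding krull_dim_def
proof (rule Sup_least, elim CollectE exE conjE)
  fix e k and C :: "nat \<Rightarrow> complex vec set"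
  assume e: "e = enat k" and C: "\<forall>i\<le>k. irreducible_closedin (zariski n) (C i)" "\<forall>i<k. C i \<subset> C (Suc i)"
  have "has_dense_image n i (C i)" if "i \<le> k" for i
    using that
  proof (induction i)
    case 0
    have "C 0 \<noteq> {}"
      using C(1) by (auto simp: irreducible_closedin_def)
    then obtain x where "x \<in> C 0"
      by blast
    \<comment> \<open>Affine \<open>0\<close>-space is a single point, so every nonempty set maps
      densely to it.\<close>
    have "polymap n 0 (\<lambda>_. 0\<^sub>v 0)"
      by (auto intro!: polymapI)
    moreover have "zariski_dense 0 ((\<lambda>_. 0\<^sub>v 0) ` C 0)"
      unfolding zariski_dense_def using \<open>x \<in> C 0\<close> by (metis carrier_vecD image_eqI vec_of_dim_0)
    ultimately show ?case
      by (auto simp: has_dense_image_def)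
  next
    case (Suc i)
    then show ?case
      using C by (intro has_dense_image_strict[of n "C i"]) (auto simp: irreducible_closedin_def)
  qed
  then obtain f where f: "polymap n k f" "zariski_dense k (f ` C k)"
    by (auto simp: has_dense_image_def)
  have "C k \<subseteq> carrier_vec n"
    using C(1) closedin_subset[of "zariski n" "C k"] by (auto simp: irreducible_closedin_def)
  then have "zariski_dense k (f ` carrier_vec n)"
    using zariski_dense_mono[OF f(2)] by blast
  then show "e \<le> enat n"
    using zariski_dense_image_le[OF f(1)] e by simp
qed

section \<open>Finite abelian groups and their characters\<close>

lemma primitive_root_of_unity:
  assumes "0 < p"
  obtains w :: complex where "\<And>k. w ^ k = 1 \<longleftrightarrow> p dvd k"
    and "\<And>z. z ^ p = 1 \<Longrightarrow> \<exists>k<p. z = w ^ k"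
proof -
  define w where "w = cis (2 * pi / real p)"
  have wk: "w ^ k = cis (2 * pi * real k / real p)" for k
    by (simp add: w_def DeMoivre mult_ac)
  then have bij: "bij_betw (\<lambda>k. w ^ k) {..<p} {z. z ^ p = 1}"
    using bij_betw_roots_unity[OF assms] by simp
  have "w ^ p = 1"
    using assms by (simp add: wk)
  have "w ^ k = 1 \<longleftrightarrow> p dvd k" for k
  proof -
    have "w ^ k = (w ^ p) ^ (k div p) * w ^ (k mod p)"
      by (metis mult_div_mod_eq power_add power_mult)
    then have "w ^ k = 1 \<longleftrightarrow> w ^ (k mod p) = w ^ 0"
      using \<open>w ^ p = 1\<close> by simp
    also have "\<dots> \<longleftrightarrow> k mod p = 0"
      using bij assms by (intro inj_on_eq_iff[of "\<lambda>k. w ^ k" "{..<p}"]) (auto simp: bij_betw_def)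
    finally show ?thesis
      by (simp add: dvd_eq_mod_eq_0)
  qed
  moreover have "\<exists>k<p. z = w ^ k" if "z ^ p = 1" for z
    using bij that unfolding bij_betw_def by blast
  ultimately show ?thesis
    using that by blast
qed

text \<open>For a \<open>p\<close>-periodic sequence \<open>u\<close> and a primitive
  \<open>p\<close>-th root of unity \<open>w\<close>, this is \<open>p\<close> times the value at
  \<open>0\<close> of the component of \<open>u\<close> on which the shift acts by
  \<open>w ^ e\<close>.\<close>

definition fourier :: "nat \<Rightarrow> complex \<Rightarrow> nat \<Rightarrow> (nat \<Rightarrow> complex) \<Rightarrow> complex" where
  "fourier p w e u = (\<Sum>b<p. inverse w ^ (e * b) * u b)"

lemma fourier_cong: "(\<And>b. u b = v b) \<Longrightarrow> fourier p w e u = fourier p w e v"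
  by (simp add: fourier_def)

lemma fourier_scale: "fourier p w e (\<lambda>b. z * u b) = z * fourier p w e u"
  by (simp add: fourier_def sum_distrib_left mult_ac)

lemma fourier_sum: "fourier p w e (\<lambda>b. \<Sum>i\<in>I. u i b) = (\<Sum>i\<in>I. fourier p w e (u i))"
  unfolding fourier_def sum_distrib_left by (rule sum.swap)

text \<open>The index is shifted by one in the sum; the two boundary terms agree because
  \<open>u p = u 0\<close> and \<open>w ^ p = 1\<close>.\<close>

lemma fourier_shift:
  assumes "w ^ p = 1" "u p = u 0" "0 < p"
  shows "fourier p w e (\<lambda>b. u (Suc b)) = w ^ e * fourier p w e u"
proof -
  define t where "t = (\<lambda>b. inverse w ^ (e * b) * u b)"
  have "w \<noteq> 0"
    using assms(1,3) by (intro notI) (simp add: zero_power)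
  have "inverse w ^ (e * p) = 1"
    using assms(1) by (simp add: power_inverse mult.commute[of e] power_mult)
  then have "t p = t 0"
    by (simp add: t_def assms(2))
  moreover have "t 0 + (\<Sum>b<p. t (Suc b)) = (\<Sum>b<p. t b) + t p"
    using sum.lessThan_Suc_shift[of t p] by simp
  ultimately have "(\<Sum>b<p. t (Suc b)) = (\<Sum>b<p. t b)"
    by simp
  have "inverse w ^ (e * b) * u (Suc b) = w ^ e * t (Suc b)" for b
    using \<open>w \<noteq> 0\<close> by (simp add: t_def power_add field_simps)
  then have "fourier p w e (\<lambda>b. u (Suc b)) = w ^ e * (\<Sum>b<p. t (Suc b))"
    unfolding fourier_def sum_distrib_left by (intro sum.cong) auto
  also have "\<dots> = w ^ e * fourier p w e u"
    unfolding \<open>(\<Sum>b<p. t (Suc b)) = (\<Sum>b<p. t b)\<close> by (simp add: fourier_def t_def)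
  finally show ?thesis .
qed

text \<open>Orthogonality: the geometric sum over \<open>e\<close> vanishes unless
  \<open>b = 0\<close>. Thus the components add up to the original value, apart from the factor
  \<open>p\<close>.\<close>

lemma sum_fourier:
  assumes w: "\<And>k. w ^ k = 1 \<longleftrightarrow> p dvd k" and "0 < p"
  shows "(\<Sum>e<p. fourier p w e u) = of_nat p * u 0"
proof -
  have "(\<Sum>e<p. inverse w ^ (e * b)) = (if b = 0 then of_nat p else 0)" if "b < p" for b
  proof -
    have "(inverse w ^ b) ^ p = 1"
      using w[of "b * p"] by (simp add: power_inverse power_mult[symmetric])
    moreover have "inverse w ^ b = 1 \<longleftrightarrow> b = 0"
      using w[of b] that by (auto simp: power_inverse dest: dvd_imp_le)
    ultimately have "(\<Sum>e<p. (inverse w ^ b) ^ e) = (if b = 0 then of_nat p else 0)"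
      by (auto simp: sum_gp_strict)
    then show ?thesis
      by (simp add: power_mult[symmetric] mult.commute)
  qed
  then have "(\<Sum>b<p. (\<Sum>e<p. inverse w ^ (e * b)) * u b) = (\<Sum>b<p. if b = 0 then of_nat p * u b else 0)"
    by (intro sum.cong) auto
  also have "\<dots> = of_nat p * u 0"
    using \<open>0 < p\<close> by simp
  finally show ?thesis
    unfolding fourier_def sum_distrib_right by (subst sum.swap)
qed

section \<open>Characters and elements of prime order\<close>

lemma character_power:
  assumes "group G" "\<And>g h. g \<in> carrier G \<Longrightarrow> h \<in> carrier G \<Longrightarrow> \<chi> (g \<otimes>\<^bsub>G\<^esub> h) = \<chi> g * \<chi> h"
    and "\<chi> \<one>\<^bsub>G\<^esub> = (1 :: complex)" "g \<in> carrier G"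
  shows "\<chi> (g [^]\<^bsub>G\<^esub> (k :: nat)) = \<chi> g ^ k"
proof -
  interpret group G by fact
  show ?thesis
    using assms by (induction k) (simp_all add: mult.commute)
qed

text \<open>Translation by the inverse of one of its elements embeds a nonempty fibre of the
  character into the kernel, and \<open>H\<close> is covered by at most \<open>p\<close>
  fibres.\<close>

lemma card_le_card_kernel:
  fixes H :: "'g set" and \<chi> :: "'g \<Rightarrow> complex"
  assumes "group G" "subgroup H G" "finite H"
    and mult: "\<And>g h. g \<in> carrier G \<Longrightarrow> h \<in> carrier G \<Longrightarrow> \<chi> (g \<otimes>\<^bsub>G\<^esub> h) = \<chi> g * \<chi> h"
    and one: "\<chi> \<one>\<^bsub>G\<^esub> = 1"
    and vals: "\<And>h. h \<in> H \<Longrightarrow> \<exists>k<p. \<chi> h = w ^ k"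
  shows "card H \<le> p * card {h \<in> H. \<chi> h = 1}"
proof -
  interpret group G by fact
  interpret H: subgroup H G by fact
  have fibre: "card {h \<in> H. \<chi> h = z} \<le> card {h \<in> H. \<chi> h = 1}" for z
  proof (cases "\<exists>g\<in>H. \<chi> g = z")
    case True
    then obtain g where g: "g \<in> H" "\<chi> g = z"
      by blast
    have inv: "\<chi> (inv\<^bsub>G\<^esub> g) * z = 1"
      using mult[of "inv\<^bsub>G\<^esub> g" g] g one by simp
    show ?thesis
    proof (rule card_inj_on_le[of "\<lambda>h. inv\<^bsub>G\<^esub> g \<otimes>\<^bsub>G\<^esub> h"])
      show "inj_on (\<lambda>h. inv\<^bsub>G\<^esub> g \<otimes>\<^bsub>G\<^esub> h) {h \<in> H. \<chi> h = z}"
        using g by (auto simp: inj_on_def)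
      show "(\<lambda>h. inv\<^bsub>G\<^esub> g \<otimes>\<^bsub>G\<^esub> h) ` {h \<in> H. \<chi> h = z} \<subseteq> {h \<in> H. \<chi> h = 1}"
        using g inv by (auto simp: mult)
    qed (use \<open>finite H\<close> in simp)
  next
    case False
    then have "{h \<in> H. \<chi> h = z} = {}"
      by blast
    then show ?thesis
      by (simp only: card.empty)
  qed
  have "H = (\<Union>k<p. {h \<in> H. \<chi> h = w ^ k})"
    using vals by blast
  then have "card H = card (\<Union>k<p. {h \<in> H. \<chi> h = w ^ k})"
    by simp
  also have "\<dots> \<le> (\<Sum>k<p. card {h \<in> H. \<chi> h = w ^ k})"
    by (rule card_UN_le) simp
  also have "\<dots> \<le> (\<Sum>k<p. card {h \<in> H. \<chi> h = 1})"
    by (rule sum_mono) (rule fibre)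
  finally show ?thesis
    by simp
qed

lemma kernel_subgroup:
  assumes "group G" "subgroup H G"
    and mult: "\<And>g h. g \<in> carrier G \<Longrightarrow> h \<in> carrier G \<Longrightarrow> \<chi> (g \<otimes>\<^bsub>G\<^esub> h) = \<chi> g * (\<chi> h :: complex)"
    and one: "\<chi> \<one>\<^bsub>G\<^esub> = 1"
  shows "subgroup {h \<in> H. \<chi> h = 1} G"
proof -
  interpret group G by fact
  interpret H: subgroup H G by fact
  have "\<chi> (inv\<^bsub>G\<^esub> h) = 1" if "h \<in> H" "\<chi> h = 1" for h
    using mult[of "inv\<^bsub>G\<^esub> h" h] that one by simp
  then show ?thesis
    by unfold_locales (auto simp: mult one)
qed

text \<open>Gaussian elimination: a nontrivial character splits off one basis element, and its kernel
  is smaller by a factor of at most \<open>p\<close>.\<close>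

lemma dual_basis:
  fixes \<Lambda> :: "('g \<Rightarrow> complex) set"
  assumes G: "comm_group G" and p: "Factorial_Ring.prime p"
    and w: "\<And>k. w ^ k = (1 :: complex) \<longleftrightarrow> p dvd k" "\<And>z. z ^ p = 1 \<Longrightarrow> \<exists>k<p. z = w ^ k"
    and mult: "\<And>\<chi> g h. \<chi> \<in> \<Lambda> \<Longrightarrow> g \<in> carrier G \<Longrightarrow> h \<in> carrier G \<Longrightarrow> \<chi> (g \<otimes>\<^bsub>G\<^esub> h) = \<chi> g * \<chi> h"
    and one: "\<And>\<chi>. \<chi> \<in> \<Lambda> \<Longrightarrow> \<chi> \<one>\<^bsub>G\<^esub> = 1"
    and "subgroup H G" "finite H"
    and "\<And>h. h \<in> H \<Longrightarrow> h [^]\<^bsub>G\<^esub> p = \<one>\<^bsub>G\<^esub>"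
    and "\<And>h. h \<in> H \<Longrightarrow> h \<noteq> \<one>\<^bsub>G\<^esub> \<Longrightarrow> \<exists>\<chi>\<in>\<Lambda>. \<chi> h \<noteq> 1"
    and "p ^ n \<le> card H"
  shows "\<exists>h \<chi>. \<forall>i<n. h i \<in> H \<and> \<chi> i \<in> \<Lambda> \<and> (\<forall>l<n. \<chi> i (h l) = (if i = l then w else 1))"
  using assms(7-)
proof (induction n arbitrary: H)
  case 0
  then show ?case by simp
next
  case (Suc n)
  interpret comm_group G by fact
  interpret H: subgroup H G by fact
  have pow: "\<chi> (g [^]\<^bsub>G\<^esub> (k :: nat)) = \<chi> g ^ k" if "\<chi> \<in> \<Lambda>" "g \<in> carrier G" for \<chi> g k
    using that by (intro character_power mult one is_group)
  have vals: "\<exists>k<p. \<chi> h = w ^ k" if "\<chi> \<in> \<Lambda>" "h \<in> H" for \<chi> h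
  proof (rule w(2))
    show "\<chi> h ^ p = 1"
      using pow[OF that(1) H.mem_carrier[OF that(2)], of p] unfolding Suc.prems(3)[OF that(2)]
      by (simp add: one[OF that(1)])
  qed
  have Hpow: "h [^]\<^bsub>G\<^esub> (k :: nat) \<in> H" if "h \<in> H" for h k
    using that by (induction k) auto
  have "1 < p"
    using p by (rule prime_gt_1_nat)
  have "1 < p ^ Suc n"
    using \<open>1 < p\<close> by (rule one_less_power) simp
  then have "H \<noteq> {\<one>\<^bsub>G\<^esub>}"
    using Suc.prems(5) by auto
  then obtain h0 where h0: "h0 \<in> H" "h0 \<noteq> \<one>\<^bsub>G\<^esub>"
    using H.one_closed by blast
  then obtain \<chi>0 where \<chi>0: "\<chi>0 \<in> \<Lambda>" "\<chi>0 h0 \<noteq> 1"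
    using Suc.prems(4) by blast
  obtain a where a: "\<chi>0 h0 = w ^ a"
    using vals[OF \<chi>0(1) h0(1)] by blast
  then have "\<not> p dvd a"
    using \<chi>0(2) w(1) by simp
  then have "coprime p a"
    using p prime_imp_coprime by blast
  \<comment> \<open>By Bezout, a power of \<open>h0\<close> is found on which the character takes
    the value \<open>w\<close> itself.\<close>
  then obtain x y where xy: "a * x = p * y + 1"
    using bezout_nat[of a p] \<open>\<not> p dvd a\<close> by (auto simp: coprime_iff_gcd_eq_1 gcd.commute)
  let ?g = "h0 [^]\<^bsub>G\<^esub> x"
  have "\<chi>0 ?g = w ^ (p * y + 1)"
    using pow[OF \<chi>0(1), of h0 x] h0 a xy by (simp add: power_mult[symmetric])
  then have g: "\<chi>0 ?g = w" "?g \<in> H"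
    using w(1)[of p] h0 by (auto simp: power_add power_mult Hpow)
  let ?K = "{h \<in> H. \<chi>0 h = 1}"
  have K: "subgroup ?K G"
    using Suc.prems(1) mult[OF \<chi>0(1)] one[OF \<chi>0(1)] by (intro kernel_subgroup is_group)
  have "p ^ Suc n \<le> p * card ?K"
    by (rule order.trans[OF Suc.prems(5) card_le_card_kernel[OF is_group Suc.prems(1,2)
        mult[OF \<chi>0(1)] one[OF \<chi>0(1)] vals[OF \<chi>0(1)]]])
  then have "p ^ n \<le> card ?K"
    using \<open>1 < p\<close> by simp
  then have "\<exists>h \<chi>. \<forall>i<n. h i \<in> ?K \<and> \<chi> i \<in> \<Lambda> \<and> (\<forall>l<n. \<chi> i (h l) = (if i = l then w else 1))"
    using Suc.prems by (intro Suc.IH K) auto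
  then obtain h \<chi> where h: "\<And>i. i < n \<Longrightarrow> h i \<in> ?K" "\<And>i. i < n \<Longrightarrow> \<chi> i \<in> \<Lambda>"
    "\<And>i l. i < n \<Longrightarrow> l < n \<Longrightarrow> \<chi> i (h l) = (if i = l then w else 1)"
    by blast
  \<comment> \<open>The values of the earlier characters at \<open>g\<close> are cleared one at a
    time. Multiplication by a power of \<open>h m\<close> changes neither the value of
    \<open>\<chi>0\<close> nor that of the other \<open>\<chi> i\<close>.\<close>
  have "\<exists>g\<in>H. \<chi>0 g = w \<and> (\<forall>i<m. \<chi> i g = 1)" if "m \<le> n" for m
    using that
  proof (induction m)
    case 0
    then show ?case using g by blast
  next
    case (Suc m)
    then obtain g where g: "g \<in> H" "\<chi>0 g = w" "\<And>i. i < m \<Longrightarrow> \<chi> i g = 1"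
      by auto
    have m: "h m \<in> H" "\<chi> m \<in> \<Lambda>" "\<chi>0 (h m) = 1"
      using h(1,2)[of m] Suc.prems by auto
    obtain a where a: "a < p" "\<chi> m g = w ^ a"
      using vals[OF m(2) g(1)] by blast
    \<comment> \<open>Exponents are natural numbers, so \<open>p - a\<close> serves in place of
      \<open>- a\<close>; this is enough as \<open>w ^ p = 1\<close>.\<close>
    let ?g = "g \<otimes>\<^bsub>G\<^esub> h m [^]\<^bsub>G\<^esub> (p - a)"
    have val: "\<psi> ?g = \<psi> g * \<psi> (h m) ^ (p - a)" if "\<psi> \<in> \<Lambda>" for \<psi>
      using that g(1) m(1) by (simp add: mult pow)
    have "\<chi> i ?g = 1" if "i < Suc m" for i
    proof (cases "i = m")
      case True
      then show ?thesis
        using val[OF m(2)] h(3)[of m m] a Suc.prems w(1)[of p] by (simp add: power_add[symmetric])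
    next
      case False
      then show ?thesis
        using val[OF h(2), of i] h(3)[of i m] that Suc.prems g(3)[of i] by simp
    qed
    moreover have "?g \<in> H"
      using g(1) m(1) by (auto simp: Hpow)
    moreover have "\<chi>0 ?g = w"
      using val[OF \<chi>0(1)] g(2) m(3) by simp
    ultimately show ?case
      by blast
  qed
  then obtain g where g: "g \<in> H" "\<chi>0 g = w" "\<And>i. i < n \<Longrightarrow> \<chi> i g = 1"
    by blast
  show ?case
    by (intro exI[of _ "h(n := g)"] exI[of _ "\<chi>(n := \<chi>0)"])
      (use g h \<chi>0 in \<open>auto simp: less_Suc_eq\<close>)
qed

text \<open>A prime divisor of the first invariant factor divides all of them, so every cyclic
  factor contributes \<open>p\<close> elements killed by \<open>p\<close>.\<close>

lemma has_rank_imp_torsion: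
  fixes G :: "('g, 'b) monoid_scheme"
  assumes G: "comm_group G" "finite (carrier G)" and "has_rank G n"
  obtains p where "Factorial_Ring.prime p" "p ^ n \<le> card {g \<in> carrier G. g [^]\<^bsub>G\<^esub> p = \<one>\<^bsub>G\<^esub>}"
proof -
  interpret comm_group G by fact
  obtain d :: "nat \<Rightarrow> nat" where d: "\<And>i. i < n \<Longrightarrow> 1 < d i" "\<And>i. Suc i < n \<Longrightarrow> d i dvd d (Suc i)"
    and iso: "G \<cong> product_group {..<n} (\<lambda>i. integer_mod_group (d i))"
    using assms(3) by (auto simp: has_rank_def)
  let ?P = "product_group {..<n} (\<lambda>i. integer_mod_group (d i))"
  have "\<exists>p. Factorial_Ring.prime p \<and> (0 < n \<longrightarrow> p dvd d 0)"
  proof (cases "n = 0")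
    case True
    then show ?thesis using two_is_prime_nat by blast
  next
    case False
    then show ?thesis
      using prime_factor_nat[of "d 0"] d(1)[of 0] by auto
  qed
  then obtain p where p: "Factorial_Ring.prime p" "0 < n \<Longrightarrow> p dvd d 0"
    by blast
  have pd: "p dvd d i" if "i < n" for i
    using that
  proof (induction i)
    case (Suc i)
    then show ?case
      using d(2)[of i] dvd_trans by auto
  qed (use p in simp)
  have quot: "0 < d i div p" "p * (d i div p) = d i" if "i < n" for i
    using pd[OF that] d(1)[OF that] p(1) by (auto elim!: dvdE simp: prime_gt_0_nat intro!: gr0I)
  have "?P \<cong> G"
    using iso by (rule iso_sym)
  then obtain \<theta> where \<theta>: "\<theta> \<in> iso ?P G"
    by (auto simp: is_iso_def)
  then have hom: "\<theta> \<in> hom ?P G" and inj: "inj_on \<theta> (carrier ?P)"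
    by (auto simp: iso_def bij_betw_def)
  have P: "group ?P"
    by simp
  \<comment> \<open>In the \<open>i\<close>-th factor, the elements killed by \<open>p\<close> are
    the multiples of \<open>d i div p\<close>; \<open>\<kappa>\<close> lists their
    combinations.\<close>
  define \<kappa> where "\<kappa> = (\<lambda>k. \<lambda>i\<in>{..<n}. int (k i * (d i div p)))"
  have carr: "\<kappa> k \<in> carrier ?P" if "k \<in> {..<n} \<rightarrow>\<^sub>E {..<p}" for k
  proof -
    have "k i * (d i div p) < d i" if i: "i < n" for i
    proof -
      have "k i < p"
        using PiE_mem[OF \<open>k \<in> _\<close>, of i] i by simp
      then have "k i * (d i div p) < p * (d i div p)"
        using quot(1)[OF i] by simp
      then show ?thesis
        using quot(2)[OF i] by simp
    qed
    then show ?thesis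
      using d(1) by (auto simp: \<kappa>_def carrier_integer_mod_group simp del: of_nat_mult)
  qed
  have powP: "(\<kappa> k [^]\<^bsub>?P\<^esub> m) = (\<lambda>i\<in>{..<n}. (int m * int (k i * (d i div p))) mod int (d i))" for k m
  proof (induction m)
    case (Suc m)
    then show ?case
      using P by (simp add: \<kappa>_def fun_eq_iff mod_simps algebra_simps)
  qed (auto simp: fun_eq_iff)
  have tors: "\<theta> (\<kappa> k) [^]\<^bsub>G\<^esub> p = \<one>\<^bsub>G\<^esub>" if k: "k \<in> {..<n} \<rightarrow>\<^sub>E {..<p}" for k
  proof -
    have "int p * int (k i * (d i div p)) mod int (d i) = 0" if "i < n" for i
      using pd[OF that] by (auto elim!: dvdE simp: mult_ac)
    then have "\<kappa> k [^]\<^bsub>?P\<^esub> p = \<one>\<^bsub>?P\<^esub>"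
      unfolding powP by (auto simp: fun_eq_iff)
    then show ?thesis
      using hom_nat_pow[OF hom carr[OF k] P is_group, of p] hom_one[OF hom P is_group] by metis
  qed
  have "card ({..<n} \<rightarrow>\<^sub>E {..<p}) \<le> card {g \<in> carrier G. g [^]\<^bsub>G\<^esub> p = \<one>\<^bsub>G\<^esub>}"
  proof (rule card_inj_on_le[of "\<theta> \<circ> \<kappa>"])
    show "inj_on (\<theta> \<circ> \<kappa>) ({..<n} \<rightarrow>\<^sub>E {..<p})"
    proof (rule comp_inj_on)
      show "inj_on \<kappa> ({..<n} \<rightarrow>\<^sub>E {..<p})"
      proof (rule inj_onI)
        fix k l
        assume kl: "k \<in> {..<n} \<rightarrow>\<^sub>E {..<p}" "l \<in> {..<n} \<rightarrow>\<^sub>E {..<p}" "\<kappa> k = \<kappa> l"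
        have "k i = l i" if i: "i < n" for i
        proof -
          have "d i div p \<noteq> 0"
            using quot(1)[OF i] by simp
          moreover have "int (k i * (d i div p)) = int (l i * (d i div p))"
            using fun_cong[OF kl(3), of i] i by (simp add: \<kappa>_def)
          ultimately show ?thesis
            by (simp only: of_nat_eq_iff mult_cancel2 simp_thms)
        qed
        then show "k = l"
          using kl(1,2) by (intro PiE_ext) auto
      qed
      show "inj_on \<theta> (\<kappa> ` ({..<n} \<rightarrow>\<^sub>E {..<p}))"
        by (rule inj_on_subset[OF inj]) (use carr in blast)
    qed
    show "(\<theta> \<circ> \<kappa>) ` ({..<n} \<rightarrow>\<^sub>E {..<p}) \<subseteq> {g \<in> carrier G. g [^]\<^bsub>G\<^esub> p = \<one>\<^bsub>G\<^esub>}"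
      using tors hom_carrier[OF hom] carr by auto
  qed (use G in simp)
  then have "p ^ n \<le> card {g \<in> carrier G. g [^]\<^bsub>G\<^esub> p = \<one>\<^bsub>G\<^esub>}"
    by (simp add: card_PiE)
  then show ?thesis
    using that p(1) by blast
qed

section \<open>Representations and semi-invariants\<close>

lemma representation_carrier:
  assumes "representation G n \<rho>" "g \<in> carrier G"
  shows "\<rho> g \<in> carrier_mat n n"
proof -
  have "\<rho> g \<in> carrier (GL n)"
    using assms unfolding representation_def by (rule hom_in_carrier)
  then show ?thesis
    by (simp add: units_of_def Units_def ring_mat_def)
qed

lemma representation_mult:
  assumes "representation G n \<rho>" "g \<in> carrier G" "h \<in> carrier G"
  shows "\<rho> (g \<otimes>\<^bsub>G\<^esub> h) = \<rho> g * \<rho> h"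
  using hom_mult[of \<rho> G "GL n" g h] assms
  by (simp add: representation_def units_of_def ring_mat_def)

lemma representation_one:
  assumes "representation G n \<rho>" "group G"
  shows "\<rho> \<one>\<^bsub>G\<^esub> = 1\<^sub>m n"
proof -
  have "group (GL n)"
    using ring.is_monoid[OF ring_mat] by (rule monoid.units_group)
  then have "\<rho> \<one>\<^bsub>G\<^esub> = \<one>\<^bsub>GL n\<^esub>"
    using assms unfolding representation_def by (intro hom_one)
  then show ?thesis
    by (simp add: units_of_def ring_mat_def)
qed

lemma representation_act_carrier:
  "representation G n \<rho> \<Longrightarrow> g \<in> carrier G \<Longrightarrow> x \<in> carrier_vec n \<Longrightarrow> \<rho> g *\<^sub>v x \<in> carrier_vec n"
  using representation_carrier by (metis mult_mat_vec_carrier)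

lemma representation_act_mult:
  assumes "representation G n \<rho>" "g \<in> carrier G" "h \<in> carrier G" "x \<in> carrier_vec n"
  shows "\<rho> (g \<otimes>\<^bsub>G\<^esub> h) *\<^sub>v x = \<rho> g *\<^sub>v (\<rho> h *\<^sub>v x)"
  unfolding representation_mult[OF assms(1-3)]
  by (rule assoc_mult_mat_vec[OF representation_carrier representation_carrier])
    (use assms in auto)

lemma representation_act_one:
  "representation G n \<rho> \<Longrightarrow> group G \<Longrightarrow> x \<in> carrier_vec n \<Longrightarrow> \<rho> \<one>\<^bsub>G\<^esub> *\<^sub>v x = x"
  by (simp add: representation_one)

lemma representation_act_commute:
  assumes "comm_group G" "representation G n \<rho>" "g \<in> carrier G" "h \<in> carrier G" "x \<in> carrier_vec n"
  shows "\<rho> g *\<^sub>v (\<rho> h *\<^sub>v x) = \<rho> h *\<^sub>v (\<rho> g *\<^sub>v x)"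
proof -
  interpret comm_group G by fact
  have "\<rho> g *\<^sub>v (\<rho> h *\<^sub>v x) = \<rho> (g \<otimes>\<^bsub>G\<^esub> h) *\<^sub>v x"
    using representation_act_mult[OF assms(2-5)] by simp
  also have "g \<otimes>\<^bsub>G\<^esub> h = h \<otimes>\<^bsub>G\<^esub> g"
    using assms(3,4) by (rule m_comm)
  also have "\<rho> (h \<otimes>\<^bsub>G\<^esub> g) *\<^sub>v x = \<rho> h *\<^sub>v (\<rho> g *\<^sub>v x)"
    using representation_act_mult[OF assms(2,4,3,5)] .
  finally show ?thesis .
qed

lemma representation_act_Suc:
  fixes b :: nat
  assumes "comm_group G" "representation G n \<rho>" "g \<in> carrier G" "x \<in> carrier_vec n"
  shows "\<rho> (g [^]\<^bsub>G\<^esub> Suc b) *\<^sub>v x = \<rho> g *\<^sub>v (\<rho> (g [^]\<^bsub>G\<^esub> b) *\<^sub>v x)"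
    and "\<rho> (g [^]\<^bsub>G\<^esub> Suc b) *\<^sub>v x = \<rho> (g [^]\<^bsub>G\<^esub> b) *\<^sub>v (\<rho> g *\<^sub>v x)"
proof -
  interpret comm_group G by fact
  have gb: "g [^]\<^bsub>G\<^esub> b \<in> carrier G"
    using assms(3) by simp
  show *: "\<rho> (g [^]\<^bsub>G\<^esub> Suc b) *\<^sub>v x = \<rho> (g [^]\<^bsub>G\<^esub> b) *\<^sub>v (\<rho> g *\<^sub>v x)"
    using representation_act_mult[OF assms(2) gb assms(3,4)] by simp
  show "\<rho> (g [^]\<^bsub>G\<^esub> Suc b) *\<^sub>v x = \<rho> g *\<^sub>v (\<rho> (g [^]\<^bsub>G\<^esub> b) *\<^sub>v x)"
    unfolding * by (rule representation_act_commute[OF assms(1,2) gb assms(3,4)])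
qed

text \<open>Since \<open>G\<close> is commutative, averaging over the powers of one element preserves
  semi-invariance under the others.\<close>

lemma separating_semi_invariant:
  assumes G: "comm_group G" "finite (carrier G)" and \<sigma>: "representation G k \<sigma>"
    and h: "h \<in> carrier G" "y \<in> carrier_vec k" "\<sigma> h *\<^sub>v y \<noteq> y"
  shows "\<exists>f \<chi>. polyfun k f \<and> f (\<sigma> h *\<^sub>v y) \<noteq> f y \<and>
    (\<forall>g\<in>carrier G. \<forall>x\<in>carrier_vec k. f (\<sigma> g *\<^sub>v x) = \<chi> g * f x)"
proof -
  interpret comm_group G by fact
  note act = representation_act_carrier[OF \<sigma>]
  \<comment> \<open>The order of \<open>G\<close> is a common exponent of all its elements, so one
    root of unity serves for every \<open>g\<close>.\<close>
  define q where "q = Coset.order G"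
  have "0 < q"
    using G(2) by (simp add: q_def order_gt_0_iff_finite)
  obtain w :: complex where w: "\<And>k. w ^ k = 1 \<longleftrightarrow> q dvd k"
    and "\<And>z. z ^ q = 1 \<Longrightarrow> \<exists>k<q. z = w ^ k"
    by (rule primitive_root_of_unity[OF \<open>0 < q\<close>]) (rule that)
  \<comment> \<open>The function is made semi-invariant under one more element at a time, starting
    from a coordinate that distinguishes \<open>y\<close> from its translate.\<close>
  have "\<exists>f. polyfun k f \<and> f (\<sigma> h *\<^sub>v y) \<noteq> f y \<and>
      (\<forall>g\<in>S. \<exists>z. \<forall>x\<in>carrier_vec k. f (\<sigma> g *\<^sub>v x) = z * f x)"
    if "finite S" "S \<subseteq> carrier G" for S
    using that
  proof (induction S rule: finite_induct)
    case empty
    have "\<sigma> h *\<^sub>v y \<in> carrier_vec k"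
      using act h by blast
    then obtain i where "i < k" "(\<sigma> h *\<^sub>v y) $ i \<noteq> y $ i"
      using h(2,3) by (metis carrier_vecD eq_vecI)
    then show ?case
      by (intro exI[of _ "\<lambda>x. x $ i"]) (simp add: polyfun_coord)
  next
    case (insert g S)
    then have g: "g \<in> carrier G" and S: "S \<subseteq> carrier G"
      by auto
    obtain f where f: "polyfun k f" "f (\<sigma> h *\<^sub>v y) \<noteq> f y"
      and eig: "\<forall>s\<in>S. \<exists>z. \<forall>x\<in>carrier_vec k. f (\<sigma> s *\<^sub>v x) = z * f x"
      using insert.IH[OF S] by blast
    define F where "F = (\<lambda>e x. fourier q w e (\<lambda>b. f (\<sigma> (g [^]\<^bsub>G\<^esub> b) *\<^sub>v x)))"
    have gb: "g [^]\<^bsub>G\<^esub> b \<in> carrier G" for b :: nat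
      using g by simp
    have poly: "polyfun k (F e)" for e
      unfolding F_def fourier_def
      by (intro polyfun_sum polyfun_mult polyfun_const polyfun_compose[OF f(1)]
          polymap_mult_mat_vec representation_carrier[OF \<sigma>] gb)
    have sumF: "(\<Sum>e<q. F e x) = of_nat q * f x" if "x \<in> carrier_vec k" for x
      unfolding F_def sum_fourier[OF w \<open>0 < q\<close>]
      using representation_act_one[OF \<sigma> is_group that] by simp
    \<comment> \<open>The components \<open>F e\<close> add up to \<open>q\<close> times
      \<open>f\<close>, so at least one of them still separates the two points.\<close>
    have "(\<Sum>e<q. F e (\<sigma> h *\<^sub>v y) - F e y) \<noteq> 0"
      using f(2) \<open>0 < q\<close> sumF h act by (simp add: sum_subtractf)
    then obtain e where e: "F e (\<sigma> h *\<^sub>v y) \<noteq> F e y"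
      by (metis (no_types, lifting) eq_iff_diff_eq_0 sum.neutral)
    have "F e (\<sigma> g *\<^sub>v x) = w ^ e * F e x" if x: "x \<in> carrier_vec k" for x
    proof -
      have "g [^]\<^bsub>G\<^esub> q = \<one>\<^bsub>G\<^esub>"
        using g by (simp add: q_def pow_order_eq_1)
      then have "fourier q w e (\<lambda>b. f (\<sigma> (g [^]\<^bsub>G\<^esub> Suc b) *\<^sub>v x)) = w ^ e * F e x"
        unfolding F_def using w[of q] \<open>0 < q\<close>
        by (intro fourier_shift[where u = "\<lambda>b. f (\<sigma> (g [^]\<^bsub>G\<^esub> b) *\<^sub>v x)"]) auto
      then show ?thesis
        unfolding F_def representation_act_Suc(2)[OF G(1) \<sigma> g x] .
    qed
    moreover have "\<exists>z. \<forall>x\<in>carrier_vec k. F e (\<sigma> s *\<^sub>v x) = z * F e x" if s: "s \<in> S" for s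
    proof -
      obtain z where z: "\<And>x. x \<in> carrier_vec k \<Longrightarrow> f (\<sigma> s *\<^sub>v x) = z * f x"
        using eig s by blast
      have "F e (\<sigma> s *\<^sub>v x) = z * F e x" if x: "x \<in> carrier_vec k" for x
      proof -
        have "F e (\<sigma> s *\<^sub>v x) = fourier q w e (\<lambda>b. z * f (\<sigma> (g [^]\<^bsub>G\<^esub> b) *\<^sub>v x))"
          unfolding F_def
        proof (rule fourier_cong)
          fix b :: nat
          have "s \<in> carrier G"
            using s S by blast
          then show "f (\<sigma> (g [^]\<^bsub>G\<^esub> b) *\<^sub>v (\<sigma> s *\<^sub>v x)) = z * f (\<sigma> (g [^]\<^bsub>G\<^esub> b) *\<^sub>v x)"
            using representation_act_commute[OF G(1) \<sigma> gb[of b] _ x] z act[OF gb[of b] x] by simp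
        qed
        then show ?thesis
          by (simp add: fourier_scale F_def)
      qed
      then show ?thesis by blast
    qed
    ultimately show ?case
      using poly[of e] e by (intro exI[of _ "F e"]) auto
  qed
  from this[OF G(2) subset_refl] obtain f where f: "polyfun k f" "f (\<sigma> h *\<^sub>v y) \<noteq> f y"
    "\<forall>g\<in>carrier G. \<exists>z. \<forall>x\<in>carrier_vec k. f (\<sigma> g *\<^sub>v x) = z * f x"
    by blast
  from bchoice[OF f(3)] f(1,2) show ?thesis
    by blast
qed

text \<open>The point \<open>c\<close> is decomposed into eigenvectors of \<open>h 0, \<dots>, h (n - 1)\<close>, and the
  eigenvector of weight \<open>e\<close> for \<open>h j\<close> is multiplied by the \<open>e\<close>-th power of the
  \<open>j\<close>-th coordinate.\<close>

lemma semi_invariant_parametrization: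
  assumes G: "comm_group G" and \<rho>: "representation G m \<rho>"
    and w: "\<And>k. w ^ k = 1 \<longleftrightarrow> p dvd k" and "0 < p"
    and h: "\<And>i. i < n \<Longrightarrow> h i \<in> carrier G" "\<And>i. i < n \<Longrightarrow> h i [^]\<^bsub>G\<^esub> p = \<one>\<^bsub>G\<^esub>"
    and c: "c \<in> carrier_vec m"
  shows "\<exists>\<psi>. polymap n m \<psi> \<and> \<psi> (vec n (\<lambda>_. 1)) = c \<and>
    (\<forall>i<n. \<forall>t\<in>carrier_vec n. \<psi> (scale_coord i w t) = \<rho> (h i) *\<^sub>v \<psi> t)"
proof -
  interpret comm_group G by fact
  note act = representation_act_carrier[OF \<rho>]
  \<comment> \<open>Induction on the number \<open>j\<close> of coordinates in use: scaling one of
    them acts through \<open>\<rho>\<close>, scaling any later one leaves the map unchanged.\<close>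
  have "\<exists>\<psi>. polymap n m \<psi> \<and> \<psi> (vec n (\<lambda>_. 1)) = c \<and> (\<forall>i<n. \<forall>t\<in>carrier_vec n.
      \<psi> (scale_coord i w t) = (if i < j then \<rho> (h i) *\<^sub>v \<psi> t else \<psi> t))" if "j \<le> n" for j
    using that
  proof (induction j)
    case 0
    show ?case
      by (rule exI[of _ "\<lambda>_. c"]) (use c in \<open>auto intro!: polymapI\<close>)
  next
    case (Suc j)
    then obtain \<psi> where \<psi>: "polymap n m \<psi>" "\<psi> (vec n (\<lambda>_. 1)) = c"
      and cov: "\<And>i t. i < n \<Longrightarrow> t \<in> carrier_vec n \<Longrightarrow>
        \<psi> (scale_coord i w t) = (if i < j then \<rho> (h i) *\<^sub>v \<psi> t else \<psi> t)"
      by auto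
    have j: "j < n"
      using Suc.prems by simp
    note hj = h(1)[OF j]
    have gb: "h j [^]\<^bsub>G\<^esub> b \<in> carrier G" for b :: nat
      using hj by simp
    \<comment> \<open>\<open>A v r e\<close> is the \<open>r\<close>-th coordinate of the component
      of \<open>v\<close> on which \<open>h j\<close> acts by \<open>w ^ e\<close>, provided that
      \<open>h j\<close> has \<open>p\<close>-th power one.\<close>
    define A where "A = (\<lambda>v r e. fourier p w e (\<lambda>b. (\<rho> (h j [^]\<^bsub>G\<^esub> b) *\<^sub>v v) $ r) / of_nat p)"
    define \<psi>' where "\<psi>' = (\<lambda>t. vec m (\<lambda>r. \<Sum>e<p. t $ j ^ e * A (\<psi> t) r e))"
    have \<psi>'_carrier: "\<psi>' t \<in> carrier_vec m" for t
      by (simp add: \<psi>'_def)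
    have poly: "polymap n m \<psi>'"
      unfolding \<psi>'_def A_def fourier_def divide_inverse
    proof (intro polymap_vec polyfun_sum polyfun_mult polyfun_power polyfun_coord polyfun_const j)
      fix r b :: nat
      assume r: "r < m"
      have "polymap n m (\<lambda>t. \<rho> (h j [^]\<^bsub>G\<^esub> b) *\<^sub>v \<psi> t)" for b :: nat
        by (rule polymap_comp[OF \<psi>(1) polymap_mult_mat_vec[OF representation_carrier[OF \<rho> gb]]])
      then show "polyfun n (\<lambda>t. (\<rho> (h j [^]\<^bsub>G\<^esub> b) *\<^sub>v \<psi> t) $ r)"
        using r by (rule polymap_polyfun)
    qed
    \<comment> \<open>At the all-ones point every component has factor one, and together they give
      back \<open>c\<close>.\<close>
    have one: "\<psi>' (vec n (\<lambda>_. 1)) = c"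
    proof (rule eq_vecI)
      fix r
      assume "r < dim_vec c"
      then have r: "r < m"
        using c by simp
      have "\<psi>' (vec n (\<lambda>_. 1)) $ r = (\<Sum>e<p. fourier p w e (\<lambda>b. (\<rho> (h j [^]\<^bsub>G\<^esub> b) *\<^sub>v c) $ r)) / of_nat p"
        using r j by (simp add: \<psi>'_def A_def \<psi>(2) sum_divide_distrib)
      also have "\<dots> = c $ r"
        unfolding sum_fourier[OF w \<open>0 < p\<close>]
        using representation_act_one[OF \<rho> is_group c] \<open>0 < p\<close> by simp
      finally show "\<psi>' (vec n (\<lambda>_. 1)) $ r = c $ r" .
    qed (use c in \<open>simp add: \<psi>'_def\<close>)
    \<comment> \<open>The matrix of \<open>g\<close> passes through the sums by linearity;
      commutation with \<open>h i\<close>, or the shift for \<open>h j\<close> itself, then applies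
      inside.\<close>
    have lin: "(\<rho> g *\<^sub>v \<psi>' t) $ r = (\<Sum>e<p. t $ j ^ e * (fourier p w e
        (\<lambda>b. (\<rho> g *\<^sub>v (\<rho> (h j [^]\<^bsub>G\<^esub> b) *\<^sub>v \<psi> t)) $ r) / of_nat p))"
      if g: "g \<in> carrier G" and t: "t \<in> carrier_vec n" and r: "r < m" for g t r
    proof -
      have mv: "(\<rho> g *\<^sub>v v) $ r = (\<Sum>l<m. \<rho> g $$ (r, l) * v $ l)" if "v \<in> carrier_vec m" for v
        using representation_carrier[OF \<rho> g] that r
        by (auto simp: scalar_prod_def atLeast0LessThan intro!: sum.cong)
      have "(\<rho> g *\<^sub>v \<psi>' t) $ r =
          (\<Sum>l<m. \<Sum>e<p. \<rho> g $$ (r, l) * (t $ j ^ e * A (\<psi> t) l e))"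
        unfolding mv[OF \<psi>'_carrier] by (rule sum.cong) (auto simp: \<psi>'_def sum_distrib_left)
      also have "\<dots> = (\<Sum>e<p. \<Sum>l<m. \<rho> g $$ (r, l) * (t $ j ^ e * A (\<psi> t) l e))"
        by (rule sum.swap)
      also have "\<dots> = (\<Sum>e<p. t $ j ^ e * (fourier p w e
        (\<lambda>b. (\<rho> g *\<^sub>v (\<rho> (h j [^]\<^bsub>G\<^esub> b) *\<^sub>v \<psi> t)) $ r) / of_nat p))"
      proof (rule sum.cong[OF refl])
        fix e
        have "fourier p w e (\<lambda>b. (\<rho> g *\<^sub>v (\<rho> (h j [^]\<^bsub>G\<^esub> b) *\<^sub>v \<psi> t)) $ r) =
            fourier p w e (\<lambda>b. \<Sum>l<m. \<rho> g $$ (r, l) * (\<rho> (h j [^]\<^bsub>G\<^esub> b) *\<^sub>v \<psi> t) $ l)"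
          by (rule fourier_cong) (rule mv[OF act[OF gb polymap_carrier[OF \<psi>(1) t]]])
        also have "\<dots> = (\<Sum>l<m. \<rho> g $$ (r, l) * (of_nat p * A (\<psi> t) l e))"
          using \<open>0 < p\<close> by (simp add: fourier_sum fourier_scale A_def)
        also have "\<dots> / of_nat p = (\<Sum>l<m. \<rho> g $$ (r, l) * A (\<psi> t) l e)"
          using \<open>0 < p\<close> by (simp add: sum_divide_distrib)
        finally show "(\<Sum>l<m. \<rho> g $$ (r, l) * (t $ j ^ e * A (\<psi> t) l e)) = t $ j ^ e *
            (fourier p w e (\<lambda>b. (\<rho> g *\<^sub>v (\<rho> (h j [^]\<^bsub>G\<^esub> b) *\<^sub>v \<psi> t)) $ r) / of_nat p)"
          by (simp add: sum_distrib_left mult_ac)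
      qed
      finally show ?thesis .
    qed
    have "\<psi>' (scale_coord i w t) = (if i < Suc j then \<rho> (h i) *\<^sub>v \<psi>' t else \<psi>' t)"
      if i: "i < n" and t: "t \<in> carrier_vec n" for i t
    proof -
      note \<psi>t = polymap_carrier[OF \<psi>(1) t]
      consider "i < j" | "i = j" | "i > j"
        by linarith
      then show ?thesis
      proof cases
        case 1
        have "\<psi>' (scale_coord i w t) = \<rho> (h i) *\<^sub>v \<psi>' t"
        proof (rule eq_vecI)
          fix r
          assume "r < dim_vec (\<rho> (h i) *\<^sub>v \<psi>' t)"
          then have r: "r < m"
            using representation_carrier[OF \<rho> h(1)[OF i]] by simp
          have "\<psi>' (scale_coord i w t) $ r = (\<Sum>e<p. t $ j ^ e * A (\<rho> (h i) *\<^sub>v \<psi> t) r e)"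
            using 1 r t j cov[OF i t] by (simp add: \<psi>'_def)
          also have "\<dots> = (\<rho> (h i) *\<^sub>v \<psi>' t) $ r"
            unfolding lin[OF h(1)[OF i] t r] A_def
            using representation_act_commute[OF G \<rho> gb h(1)[OF i] \<psi>t] by simp
          finally show "\<psi>' (scale_coord i w t) $ r = (\<rho> (h i) *\<^sub>v \<psi>' t) $ r" .
        qed (use representation_carrier[OF \<rho> h(1)[OF i]] in \<open>simp add: \<psi>'_def\<close>)
        with 1 show ?thesis by simp
      next
        case 2
        have "\<psi>' (scale_coord j w t) = \<rho> (h j) *\<^sub>v \<psi>' t"
        proof (rule eq_vecI)
          fix r
          assume "r < dim_vec (\<rho> (h j) *\<^sub>v \<psi>' t)"
          then have r: "r < m"
            using representation_carrier[OF \<rho> hj] by simp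
          have shift: "fourier p w e (\<lambda>b. (\<rho> (h j [^]\<^bsub>G\<^esub> Suc b) *\<^sub>v \<psi> t) $ r) =
              w ^ e * fourier p w e (\<lambda>b. (\<rho> (h j [^]\<^bsub>G\<^esub> b) *\<^sub>v \<psi> t) $ r)" for e
            using w[of p] \<open>0 < p\<close> h(2)[OF j]
            by (intro fourier_shift[where u = "\<lambda>b. (\<rho> (h j [^]\<^bsub>G\<^esub> b) *\<^sub>v \<psi> t) $ r"]) auto
          have "\<psi>' (scale_coord j w t) $ r = (\<Sum>e<p. (w * t $ j) ^ e * A (\<psi> t) r e)"
            using r t j cov[OF j t] by (simp add: \<psi>'_def)
          also have "\<dots> = (\<Sum>e<p. t $ j ^ e * (w ^ e * A (\<psi> t) r e))"
            by (simp add: power_mult_distrib mult_ac)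
          also have "\<dots> = (\<rho> (h j) *\<^sub>v \<psi>' t) $ r"
            unfolding lin[OF hj t r] representation_act_Suc(1)[OF G \<rho> hj \<psi>t, symmetric] shift A_def
            by simp
          finally show "\<psi>' (scale_coord j w t) $ r = (\<rho> (h j) *\<^sub>v \<psi>' t) $ r" .
        qed (use representation_carrier[OF \<rho> hj] in \<open>simp add: \<psi>'_def\<close>)
        with 2 show ?thesis by simp
      next
        case 3
        then show ?thesis
          using t j cov[OF i t] by (simp add: \<psi>'_def)
      qed
    qed
    with poly one show ?case
      by (intro exI[of _ \<psi>']) blast
  qed
  from this[of n] show ?thesis
    by auto
qed

section \<open>Coordinate subspaces and the chain of image closures\<close>

definition pad_ones :: "nat \<Rightarrow> nat \<Rightarrow> complex vec \<Rightarrow> complex vec" where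
  "pad_ones n j t = vec n (\<lambda>l. if l < j then t $ l else 1)"

lemma polymap_pad_ones: "polymap j n (pad_ones n j)"
  unfolding pad_ones_def
proof (rule polymap_vec)
  show "polyfun j (\<lambda>t. if i < j then t $ i else 1)" for i
    by (cases "i < j") (auto intro: polyfun_coord)
qed

lemma pad_ones_Suc_image: "pad_ones n j ` carrier_vec j \<subseteq> pad_ones n (Suc j) ` carrier_vec (Suc j)"
proof (rule image_subsetI)
  fix t
  have "pad_ones n j t = pad_ones n (Suc j) (pad_ones (Suc j) j t)"
    by (auto simp: pad_ones_def)
  then show "pad_ones n j t \<in> pad_ones n (Suc j) ` carrier_vec (Suc j)"
    by (simp add: pad_ones_def)
qed

lemma pad_ones_scale_coord:
  assumes "l < j" "t \<in> carrier_vec j"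
  shows "pad_ones n j (scale_coord l w t) = scale_coord l w (pad_ones n j t)"
  using assms by (auto simp: pad_ones_def scale_coord_def)

text \<open>Faithfulness makes the characters of semi-invariants that do not vanish on the image
  separate the elements killed by \<open>p\<close>. A dual basis among them makes the composites
  semi-invariant under each coordinate scaling, with the characters that
  \<open>semi_invariant_map_dense\<close> expects.\<close>

lemma faithful_covariant_dense_semi_invariants:
  assumes G: "comm_group G" "finite (carrier G)" and p: "Factorial_Ring.prime p"
    and card: "p ^ n \<le> card {g \<in> carrier G. g [^]\<^bsub>G\<^esub> p = \<one>\<^bsub>G\<^esub>}"
    and \<phi>: "faithful_covariant G m \<rho> k \<sigma> \<phi>"
  shows "\<exists>\<psi> L. polymap n m \<psi> \<and> (\<forall>i<n. polyfun k (L i)) \<and> (\<forall>j\<le>n. zariski_dense j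
    ((\<lambda>t. vec j (\<lambda>i. L i (\<phi> (\<psi> (pad_ones n j t))))) ` carrier_vec j))"
proof -
  interpret comm_group G by fact
  have \<rho>: "representation G m \<rho>" and \<sigma>: "representation G k \<sigma>" and pm: "polymap m k \<phi>"
    and equiv: "\<And>g x. g \<in> carrier G \<Longrightarrow> x \<in> carrier_vec m \<Longrightarrow> \<phi> (\<rho> g *\<^sub>v x) = \<sigma> g *\<^sub>v \<phi> x"
    and faithful: "\<And>g. g \<in> carrier G \<Longrightarrow> g \<noteq> \<one>\<^bsub>G\<^esub> \<Longrightarrow> \<exists>x\<in>carrier_vec m. \<sigma> g *\<^sub>v \<phi> x \<noteq> \<phi> x"
    using \<phi> unfolding faithful_covariant_def covariant_def by blast+
  have "1 < p"
    using p by (rule prime_gt_1_nat)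
  then have "0 < p" by simp
  obtain w :: complex where w: "\<And>k. w ^ k = 1 \<longleftrightarrow> p dvd k"
    and w_roots: "\<And>z. z ^ p = 1 \<Longrightarrow> \<exists>k<p. z = w ^ k"
    by (rule primitive_root_of_unity[OF \<open>0 < p\<close>]) (rule that)
  let ?H = "{g \<in> carrier G. g [^]\<^bsub>G\<^esub> p = \<one>\<^bsub>G\<^esub>}"
  have H: "subgroup ?H G"
  proof
    show "inv\<^bsub>G\<^esub> x \<in> ?H" if "x \<in> ?H" for x
      using that by (simp add: nat_pow_inv)
  qed (auto simp: pow_mult_distrib m_comm)
  \<comment> \<open>Being nonzero somewhere on the image lets \<open>f\<close> be cancelled, which
    makes \<open>\<chi>\<close> multiplicative on \<open>G\<close>.\<close>
  define wt where "wt = (\<lambda>f \<chi>. polyfun k f \<and> (\<exists>x\<in>carrier_vec m. f (\<phi> x) \<noteq> 0) \<and>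
    (\<forall>g\<in>carrier G. \<forall>y\<in>carrier_vec k. f (\<sigma> g *\<^sub>v y) = \<chi> g * f y))"
  define \<Lambda> where "\<Lambda> = {\<chi>. \<exists>f. wt f \<chi>}"
  have mult: "\<chi> (g \<otimes>\<^bsub>G\<^esub> h) = \<chi> g * \<chi> h" if \<chi>: "\<chi> \<in> \<Lambda>" and gh: "g \<in> carrier G" "h \<in> carrier G" for \<chi> g h
  proof -
    obtain f x where f: "x \<in> carrier_vec m" "f (\<phi> x) \<noteq> 0"
      "\<And>g y. g \<in> carrier G \<Longrightarrow> y \<in> carrier_vec k \<Longrightarrow> f (\<sigma> g *\<^sub>v y) = \<chi> g * f y"
      using \<chi> by (auto simp: \<Lambda>_def wt_def)
    note y = polymap_carrier[OF pm f(1)]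
    have "\<chi> (g \<otimes>\<^bsub>G\<^esub> h) * f (\<phi> x) = f (\<sigma> g *\<^sub>v (\<sigma> h *\<^sub>v \<phi> x))"
      using f(3)[OF m_closed[OF gh] y] representation_act_mult[OF \<sigma> gh y] by simp
    also have "\<dots> = \<chi> g * \<chi> h * f (\<phi> x)"
      using f(3) gh y representation_act_carrier[OF \<sigma> gh(2) y] by simp
    finally show ?thesis
      using f(2) by simp
  qed
  have one: "\<chi> \<one>\<^bsub>G\<^esub> = 1" if \<chi>: "\<chi> \<in> \<Lambda>" for \<chi>
  proof -
    obtain f x where f: "x \<in> carrier_vec m" "f (\<phi> x) \<noteq> 0"
      "\<And>g y. g \<in> carrier G \<Longrightarrow> y \<in> carrier_vec k \<Longrightarrow> f (\<sigma> g *\<^sub>v y) = \<chi> g * f y"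
      using \<chi> by (auto simp: \<Lambda>_def wt_def)
    note y = polymap_carrier[OF pm f(1)]
    show ?thesis
      using f(3)[OF one_closed y] f(2) representation_act_one[OF \<sigma> is_group y] by simp
  qed
  have sep: "\<exists>\<chi>\<in>\<Lambda>. \<chi> h \<noteq> 1" if h: "h \<in> ?H" "h \<noteq> \<one>\<^bsub>G\<^esub>" for h
  proof -
    have hG: "h \<in> carrier G"
      using h by simp
    obtain x where x: "x \<in> carrier_vec m" "\<sigma> h *\<^sub>v \<phi> x \<noteq> \<phi> x"
      using faithful[OF hG h(2)] by blast
    obtain f \<chi> where f: "polyfun k f" "f (\<sigma> h *\<^sub>v \<phi> x) \<noteq> f (\<phi> x)"
      "\<And>g y. g \<in> carrier G \<Longrightarrow> y \<in> carrier_vec k \<Longrightarrow> f (\<sigma> g *\<^sub>v y) = \<chi> g * f y"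
      using separating_semi_invariant[OF G \<sigma> hG polymap_carrier[OF pm x(1)] x(2)] by blast
    have "f (\<sigma> h *\<^sub>v \<phi> x) = \<chi> h * f (\<phi> x)"
      using f(3)[OF hG polymap_carrier[OF pm x(1)]] .
    then have "\<chi> h \<noteq> 1" "f (\<phi> x) \<noteq> 0"
      using f(2) by auto
    moreover from this have "wt f \<chi>"
      unfolding wt_def using f(1,3) x(1) by blast
    ultimately show ?thesis
      by (auto simp: \<Lambda>_def)
  qed
  have "\<exists>h \<chi>. \<forall>i<n. h i \<in> ?H \<and> \<chi> i \<in> \<Lambda> \<and> (\<forall>l<n. \<chi> i (h l) = (if i = l then w else 1))"
  proof (rule dual_basis[where G = G and p = p and \<Lambda> = \<Lambda>])
    show "\<exists>\<chi>\<in>\<Lambda>. \<chi> h \<noteq> 1" if "h \<in> ?H" "h \<noteq> \<one>\<^bsub>G\<^esub>" for h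
      using that by (rule sep)
  qed (use G p w w_roots mult one H card in auto)
  then obtain h \<chi> where h: "\<And>i. i < n \<Longrightarrow> h i \<in> ?H" "\<And>i. i < n \<Longrightarrow> \<chi> i \<in> \<Lambda>"
    "\<And>i l. i < n \<Longrightarrow> l < n \<Longrightarrow> \<chi> i (h l) = (if i = l then w else 1)"
    by blast
  have "\<forall>i\<in>{..<n}. \<exists>f. wt f (\<chi> i)"
    using h(2) by (auto simp: \<Lambda>_def)
  from bchoice[OF this] obtain L where "\<forall>i\<in>{..<n}. wt (L i) (\<chi> i)"
    by blast
  then have L: "wt (L i) (\<chi> i)" if "i < n" for i
    using that by simp
  have poly: "polyfun k (L i)" if "i < n" for i
    using L[OF that] by (simp add: wt_def)
  \<comment> \<open>A single point \<open>c\<close> at which all the \<open>L i\<close> are nonzero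
    on the image keeps every composite from being identically zero.\<close>
  have "\<exists>c\<in>carrier_vec m. \<forall>i\<in>{..<n}. L i (\<phi> c) \<noteq> 0"
    using L poly by (intro polyfun_common_nonzero polyfun_compose[OF _ pm]) (auto simp: wt_def)
  then obtain c where c: "c \<in> carrier_vec m" "\<And>i. i < n \<Longrightarrow> L i (\<phi> c) \<noteq> 0"
    by blast
  have hG: "h i \<in> carrier G" "h i [^]\<^bsub>G\<^esub> p = \<one>\<^bsub>G\<^esub>" if "i < n" for i
    using h(1)[OF that] by simp_all
  obtain \<psi> where \<psi>: "polymap n m \<psi>" "\<psi> (vec n (\<lambda>_. 1)) = c"
    and cov: "\<And>i t. i < n \<Longrightarrow> t \<in> carrier_vec n \<Longrightarrow> \<psi> (scale_coord i w t) = \<rho> (h i) *\<^sub>v \<psi> t"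
    using semi_invariant_parametrization[where h = h and n = n, OF G(1) \<rho> w \<open>0 < p\<close> hG c(1)] by blast
  have "zariski_dense j ((\<lambda>t. vec j (\<lambda>i. L i (\<phi> (\<psi> (pad_ones n j t))))) ` carrier_vec j)"
    if j: "j \<le> n" for j
  proof (rule semi_invariant_map_dense[OF w \<open>1 < p\<close>])
    have "polymap j k (\<lambda>t. \<phi> (\<psi> (pad_ones n j t)))"
      by (rule polymap_comp[OF polymap_comp[OF polymap_pad_ones \<psi>(1)] pm])
    then show "polymap j j (\<lambda>t. vec j (\<lambda>i. L i (\<phi> (\<psi> (pad_ones n j t)))))"
      using j by (intro polymap_vec polyfun_compose[OF poly]) auto
  next
    fix i l and t :: "complex vec"
    assume i: "i < j" and l: "l < j" and t: "t \<in> carrier_vec j"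
    let ?v = "\<psi> (pad_ones n j t)"
    have pad: "pad_ones n j t \<in> carrier_vec n"
      by (simp add: pad_ones_def)
    have v: "?v \<in> carrier_vec m"
      using polymap_carrier[OF \<psi>(1) pad] .
    have "\<psi> (pad_ones n j (scale_coord l w t)) = \<rho> (h l) *\<^sub>v ?v"
      using cov[OF _ pad, of l] l j by (simp add: pad_ones_scale_coord[OF l t])
    then have "L i (\<phi> (\<psi> (pad_ones n j (scale_coord l w t)))) = L i (\<sigma> (h l) *\<^sub>v \<phi> ?v)"
      using equiv[OF hG(1) v, of l] l j by simp
    also have "\<dots> = \<chi> i (h l) * L i (\<phi> ?v)"
      using L[of i] hG(1)[of l] polymap_carrier[OF pm v] i l j by (simp add: wt_def)
    also have "\<chi> i (h l) = (if i = l then w else 1)"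
      using h(3)[of i l] i l j by simp
    finally show "vec j (\<lambda>i. L i (\<phi> (\<psi> (pad_ones n j (scale_coord l w t))))) $ i =
        (if i = l then w else 1) * vec j (\<lambda>i. L i (\<phi> ?v)) $ i"
      using i by simp
  next
    fix i
    assume i: "i < j"
    \<comment> \<open>This is why the missing coordinates are set to one: for every \<open>j\<close>
      the subspace contains the all-ones point, which \<open>\<psi>\<close> sends to
      \<open>c\<close>.\<close>
    have "pad_ones n j (vec j (\<lambda>_. 1)) = vec n (\<lambda>_. 1)"
      by (auto simp: pad_ones_def)
    then show "\<exists>t\<in>carrier_vec j. vec j (\<lambda>i. L i (\<phi> (\<psi> (pad_ones n j t)))) $ i \<noteq> 0"
      using c(2)[of i] i j \<psi>(2) by (intro bexI[of _ "vec j (\<lambda>_. 1)"]) auto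
  qed
  then show ?thesis
    using \<psi>(1) poly by blast
qed

text \<open>If the closure were a proper subset, an equation vanishing on it could be adjoined to
  the \<open>n\<close> independent functions, giving \<open>n + 1\<close> independent functions on
  affine \<open>n\<close>-space.\<close>

lemma zariski_dense_closure_affine:
  assumes f: "polymap n n f" and dense: "zariski_dense n (f ` S)" and S: "S \<subseteq> carrier_vec n"
  shows "zariski n closure_of S = carrier_vec n"
proof (rule ccontr)
  let ?Z = "zariski n closure_of S"
  assume "?Z \<noteq> carrier_vec n"
  then have "?Z \<subset> carrier_vec n"
    using closure_of_subset_topspace[of "zariski n" S] by auto
  moreover have "irreducible_closedin (zariski n) (carrier_vec n)"
    using irreducible_closure_of_image[of n n "\<lambda>x. x"] closure_of_topspace[of "zariski n"]
    by (simp add: polymap_def polyfun_coord)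
  moreover have "has_dense_image n n ?Z"
    unfolding has_dense_image_def
    using f zariski_dense_mono[OF dense image_mono[OF closure_of_subset]] S by auto
  ultimately have "has_dense_image n (Suc n) (carrier_vec n)"
    by (intro has_dense_image_strict[of n ?Z]) auto
  then show False
    using zariski_dense_image_le[of n "Suc n"] by (auto simp: has_dense_image_def)
qed

lemma krull_dim_image_closure_ge:
  assumes \<phi>: "polymap m k \<phi>" and \<psi>: "polymap n m \<psi>" and L: "\<And>i. i < n \<Longrightarrow> polyfun k (L i)"
    and dense: "\<And>j. j \<le> n \<Longrightarrow> zariski_dense j
      ((\<lambda>t. vec j (\<lambda>i. L i (\<phi> (\<psi> (pad_ones n j t))))) ` carrier_vec j)"
  shows "enat n \<le> map_dim m k \<phi>"
proof -
  define \<Phi> where "\<Phi> = (\<lambda>j t. \<phi> (\<psi> (pad_ones n j t)))"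
  define C where "C = (\<lambda>j. zariski k closure_of (\<Phi> j ` carrier_vec j))"
  have \<Phi>: "polymap j k (\<Phi> j)" for j
    unfolding \<Phi>_def by (rule polymap_comp[OF polymap_comp[OF polymap_pad_ones \<psi>] \<phi>])
  then have sub: "\<Phi> j ` carrier_vec j \<subseteq> carrier_vec k" for j
    by (auto dest: polymap_carrier)
  have "\<Phi> j ` carrier_vec j \<subseteq> \<phi> ` carrier_vec m" for j
    unfolding \<Phi>_def using polymap_carrier[OF polymap_comp[OF polymap_pad_ones \<psi>]] by auto
  then have C_sub: "C j \<subseteq> image_closure m k \<phi>" for j
    unfolding C_def image_closure_def by (rule closure_of_mono)
  have irr: "irreducible_closedin (zariski k) (C j)" for j
    unfolding C_def by (rule irreducible_closure_of_image[OF \<Phi>])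
  have mono: "C j \<subseteq> C (Suc j)" for j
  proof -
    have "\<Phi> j ` carrier_vec j = (\<lambda>x. \<phi> (\<psi> x)) ` pad_ones n j ` carrier_vec j" for j
      by (simp add: \<Phi>_def image_image)
    then show ?thesis
      unfolding C_def using pad_ones_Suc_image[of n j] by (intro closure_of_mono) (simp add: image_mono)
  qed
  have strict: "C j \<noteq> C (Suc j)" if j: "j < n" for j
  proof
    \<comment> \<open>Then the first \<open>Suc j\<close> semi-invariants would be independent
      already on the image of a space of dimension \<open>j\<close>.\<close>
    assume eq: "C j = C (Suc j)"
    let ?\<Lambda> = "\<lambda>y. vec (Suc j) (\<lambda>i. L i y)"
    have \<Lambda>: "polymap k (Suc j) ?\<Lambda>"
      using L j by (intro polymap_vec) auto
    have "zariski_dense (Suc j) (?\<Lambda> ` \<Phi> (Suc j) ` carrier_vec (Suc j))"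
      using dense[of "Suc j"] j by (simp add: \<Phi>_def image_image)
    moreover have "\<Phi> (Suc j) ` carrier_vec (Suc j) \<subseteq> C j"
      unfolding eq unfolding C_def using sub by (intro closure_of_subset) simp
    ultimately have "zariski_dense (Suc j) (?\<Lambda> ` C j)"
      by (meson image_mono zariski_dense_mono)
    then have "zariski_dense (Suc j) (?\<Lambda> ` \<Phi> j ` carrier_vec j)"
      unfolding C_def by (rule has_dense_image_closure[OF \<Lambda> _ sub])
    then have "zariski_dense (Suc j) ((\<lambda>t. ?\<Lambda> (\<Phi> j t)) ` carrier_vec j)"
      by (simp add: image_image)
    then have "Suc j \<le> j"
      by (rule zariski_dense_image_le[OF polymap_comp[OF \<Phi> \<Lambda>]])
    then show False by simp
  qed
  have "closedin (zariski k) (image_closure m k \<phi>)"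
    by (simp add: image_closure_def)
  then have "irreducible_closedin (subtopology (zariski k) (image_closure m k \<phi>)) (C j)" for j
    using irr C_sub by (simp add: irreducible_closedin_subtopology)
  then show ?thesis
    unfolding map_dim_def krull_dim_def using mono strict
    by (intro Sup_upper CollectI exI[of _ n] conjI refl exI[of _ C]) auto
qed

section \<open>Dominance and covariant dimension\<close>

theorem theorem3p1:
  fixes G :: "('g, 'b) monoid_scheme"
    and n :: nat
    and \<rho> :: "'g \<Rightarrow> complex mat"
  assumes "comm_group G" and "finite (carrier G)"
    and "has_rank G n"
    and "faithful_representation G n \<rho>"
  shows "(\<forall>\<phi>. faithful_covariant G n \<rho> n \<rho> \<phi> \<longrightarrow> dominant n n \<phi>) \<and>
         covdim G = enat n"
proof -
  interpret comm_group G by fact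
  obtain p where p: "Factorial_Ring.prime p" "p ^ n \<le> card {g \<in> carrier G. g [^]\<^bsub>G\<^esub> p = \<one>\<^bsub>G\<^esub>}"
    by (rule has_rank_imp_torsion[OF assms(1-3)])
  note dense = faithful_covariant_dense_semi_invariants[OF assms(1,2) p]
  have \<rho>: "representation G n \<rho>" "inj_on \<rho> (carrier G)"
    using assms(4) by (auto simp: faithful_representation_def)
  have "dominant n n \<phi>" if \<phi>: "faithful_covariant G n \<rho> n \<rho> \<phi>" for \<phi>
  proof -
    have pm: "polymap n n \<phi>"
      using \<phi> by (simp add: faithful_covariant_def covariant_def)
    obtain \<psi> L where \<psi>: "polymap n n \<psi>" and L: "\<And>i. i < n \<Longrightarrow> polyfun n (L i)"
      and d: "\<And>j. j \<le> n \<Longrightarrow> zariski_dense j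
        ((\<lambda>t. vec j (\<lambda>i. L i (\<phi> (\<psi> (pad_ones n j t))))) ` carrier_vec j)"
      using dense[OF \<phi>] by blast
    have "(\<lambda>t. vec n (\<lambda>i. L i (\<phi> (\<psi> (pad_ones n n t))))) ` carrier_vec n
        \<subseteq> (\<lambda>y. vec n (\<lambda>i. L i y)) ` \<phi> ` carrier_vec n"
      using polymap_carrier[OF polymap_comp[OF polymap_pad_ones \<psi>]] by blast
    with d[of n] have "zariski_dense n ((\<lambda>y. vec n (\<lambda>i. L i y)) ` \<phi> ` carrier_vec n)"
      by (auto intro: zariski_dense_mono)
    then show ?thesis
      unfolding dominant_def image_closure_def using L polymap_carrier[OF pm]
      by (intro zariski_dense_closure_affine[OF polymap_vec]) auto
  qed
  moreover have "covdim G = enat n"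
  proof (rule antisym)
    \<comment> \<open>Upper bound: the identity map of the given faithful representation is a
      faithful covariant, and its dimension is that of affine \<open>n\<close>-space.\<close>
    have "polymap n n (\<lambda>x. x)"
      by (simp add: polymap_def polyfun_coord)
    moreover have "g = \<one>\<^bsub>G\<^esub>" if g: "g \<in> carrier G" "\<forall>y\<in>carrier_vec n. \<rho> g *\<^sub>v y = y" for g
    proof -
      have "\<rho> g = 1\<^sub>m n"
      proof (rule eq_matI)
        fix i j
        assume "i < dim_row (1\<^sub>m n)" "j < dim_col (1\<^sub>m n)"
        then have ij: "i < n" "j < n"
          by simp_all
        have "(\<rho> g *\<^sub>v unit_vec n j) $ i = \<rho> g $$ (i, j)"
          using representation_carrier[OF \<rho>(1) g(1)] ij by simp
        then show "\<rho> g $$ (i, j) = 1\<^sub>m n $$ (i, j)"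
          using g(2) ij by simp
      qed (use representation_carrier[OF \<rho>(1) g(1)] in auto)
      then have "\<rho> g = \<rho> \<one>\<^bsub>G\<^esub>"
        using representation_one[OF \<rho>(1) is_group] by simp
      then show ?thesis
        using \<rho>(2) g(1) by (simp add: inj_on_eq_iff)
    qed
    ultimately have "faithful_covariant G n \<rho> n \<rho> (\<lambda>x. x)"
      using \<rho>(1) by (auto simp: faithful_covariant_def covariant_def)
    then have "covdim G \<le> map_dim n n (\<lambda>x. x)"
      unfolding covdim_def by (intro Inf_lower) blast
    also have "\<dots> = krull_dim (zariski n)"
      using closure_of_topspace[of "zariski n"] subtopology_topspace[of "zariski n"]
      by (simp add: map_dim_def image_closure_def)
    also have "\<dots> \<le> enat n"
      by (rule krull_dim_affine_le)
    finally show "covdim G \<le> enat n" .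
    \<comment> \<open>Lower bound: between any two modules, the closure of the image of a faithful
      covariant contains a chain of length \<open>n\<close>.\<close>
    show "enat n \<le> covdim G"
      unfolding covdim_def
    proof (rule Inf_greatest, elim CollectE exE conjE)
      fix x m \<rho>' k \<sigma> \<phi>
      assume x: "x = map_dim m k \<phi>" and \<phi>: "faithful_covariant G m \<rho>' k \<sigma> \<phi>"
      have pm: "polymap m k \<phi>"
        using \<phi> by (simp add: faithful_covariant_def covariant_def)
      obtain \<psi> L where "polymap n m \<psi>" "\<And>i. i < n \<Longrightarrow> polyfun k (L i)"
        "\<And>j. j \<le> n \<Longrightarrow> zariski_dense j
          ((\<lambda>t. vec j (\<lambda>i. L i (\<phi> (\<psi> (pad_ones n j t))))) ` carrier_vec j)"
        using dense[OF \<phi>] by blast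
      then show "enat n \<le> x"
        unfolding x by (rule krull_dim_image_closure_ge[OF pm])
    qed
  qed
  ultimately show ?thesis
    by blast
qed

end
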